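(* Let $G\subset\mathbb{R}^n$ be an open bounded set and let $P:G\to\mathbb{R}$ be a $C^\infty$ function which is bounded with all its derivatives and satisfies $\nabla P(y)\neq0$ for all $y\in G$. Let $V=L^2(G)$ and let $\Omega:V\to V$ be the bounded multiplication operator $(\Omega f)(y)=P(y)f(y)$, with resolvent $R(z)=1/(z-\Omega)$ for $\operatorname{Im}z\neq0$. For any test function $\varphi$ on the complex plane the integral $$R(\varphi)=\int d^2z\,\frac{\varphi(z)}{z-\Omega},\qquad (R(\varphi)f)(y)=\int d^2z\,\frac{\varphi(z)}{z-P(y)}\,f(y),$$ exists and defines an $L(V)$-valued distribution satisfying the distribution resolvent equation on $\mathbb{C}$. Its spectral Schwartz distribution is $$(M(\varphi)f)(y)=\varphi(P(y))\,f(y).$$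
   Context: $L(V)$ is the Banach algebra of bounded operators on $V$; test functions are $C^\infty$ functions of compact support on $\mathbb{C}$; $d^2z=dx\,dy$. $\overline{\partial}=\frac12(\partial_x+i\partial_y)$ and $(\overline{\partial}T)(\varphi)=-T(\overline{\partial}\varphi)$ for distributions $T$. An $L(V)$-valued distribution $R$ on $\mathbb{C}$ satisfies the distribution resolvent equation if for all test functions $\varphi_1,\varphi_2$ $$R(\varphi_1)R(\varphi_2)=\int d^2z_1\,R(z_1)\varphi_1(z_1)\int d^2z_2\,\frac{\varphi_2(z_2)}{z_2-z_1}-\int d^2z_2\,R(z_2)\varphi_2(z_2)\int d^2z_1\,\frac{\varphi_1(z_1)}{z_2-z_1}.$$ Its spectral Schwartz distribution is $M=\frac1\pi\overline{\partial}R$. *)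

theory Defs
  imports "HOL-Analysis.Analysis"
begin

section \<open>Smooth functions and test functions\<close>

text \<open>\<^term>\<open>frechet_derivative g (at x) v\<close> is the derivative of \<open>g\<close> at \<open>x\<close> in direction \<open>v\<close>;
  for lists over \<^term>\<open>Basis\<close> the following are the iterated partial derivatives.\<close>

primrec iter_deriv ::
  "'a::real_normed_vector list \<Rightarrow> ('a \<Rightarrow> 'b::real_normed_vector) \<Rightarrow> 'a \<Rightarrow> 'b" where
  "iter_deriv [] f = f"
| "iter_deriv (v # vs) f = (\<lambda>x. frechet_derivative (iter_deriv vs f) (at x) v)"

text \<open>Meant for open \<open>S\<close>: every iterated partial derivative is again differentiable, so all
  partial derivatives of all orders exist and are continuous.\<close>

definition smooth_on :: "'a::euclidean_space set \<Rightarrow> ('a \<Rightarrow> 'b::real_normed_vector) \<Rightarrow> bool" where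
  "smooth_on S f \<longleftrightarrow> (\<forall>vs \<in> lists Basis. \<forall>x\<in>S. iter_deriv vs f differentiable (at x))"

definition bounded_derivs_on ::
    "'a::euclidean_space set \<Rightarrow> ('a \<Rightarrow> 'b::real_normed_vector) \<Rightarrow> bool" where
  "bounded_derivs_on S f \<longleftrightarrow> (\<forall>vs \<in> lists Basis. bounded (iter_deriv vs f ` S))"

definition gradient :: "(real ^ 'n \<Rightarrow> real) \<Rightarrow> real ^ 'n \<Rightarrow> real ^ 'n" where
  "gradient P y = (\<chi> i. frechet_derivative P (at y) (axis i 1))"

definition fsupport :: "(complex \<Rightarrow> complex) \<Rightarrow> complex set" where
  "fsupport \<phi> = closure {z. \<phi> z \<noteq> 0}"

definition test_functions :: "(complex \<Rightarrow> complex) set" where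
  "test_functions = {\<phi>. smooth_on UNIV \<phi> \<and> compact (fsupport \<phi>)}"

definition test_seminorm :: "nat \<Rightarrow> (complex \<Rightarrow> complex) \<Rightarrow> real" where
  "test_seminorm N \<phi> =
     (\<Sum>vs \<in> {vs \<in> lists Basis. length vs \<le> N}. SUP z. cmod (iter_deriv vs \<phi> z))"

definition dbar :: "(complex \<Rightarrow> complex) \<Rightarrow> complex \<Rightarrow> complex" where
  "dbar \<phi> z = (frechet_derivative \<phi> (at z) 1 + \<i> * frechet_derivative \<phi> (at z) \<i>) / 2"

section \<open>Complex normed spaces and their bounded operators\<close>

text \<open>\<open>L\<^sup>2(G)\<close> depends on the set \<open>G\<close>, so the spaces are given by explicit carriers.\<close>

record 'v normed_sp =
  vcarrier :: "'v set"
  vadd :: "'v \<Rightarrow> 'v \<Rightarrow> 'v"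
  vscale :: "complex \<Rightarrow> 'v \<Rightarrow> 'v"
  vnorm :: "'v \<Rightarrow> real"

record 'v hilbert_sp = "'v normed_sp" +
  vinner :: "'v \<Rightarrow> 'v \<Rightarrow> complex"

text \<open>The algebra \<open>L(V)\<close>; operators are extensional, so that they are equal iff they agree
  on the carrier.\<close>

definition bounded_ops :: "('v, 'm) normed_sp_scheme \<Rightarrow> ('v \<Rightarrow> 'v) set" where
  "bounded_ops V = {T \<in> vcarrier V \<rightarrow>\<^sub>E vcarrier V.
     (\<forall>u \<in> vcarrier V. \<forall>v \<in> vcarrier V. T (vadd V u v) = vadd V (T u) (T v)) \<and>
     (\<forall>c. \<forall>u \<in> vcarrier V. T (vscale V c u) = vscale V c (T u)) \<and>
     (\<exists>C. \<forall>u \<in> vcarrier V. vnorm V (T u) \<le> C * vnorm V u)}"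

definition op_norm :: "('v, 'm) normed_sp_scheme \<Rightarrow> ('v \<Rightarrow> 'v) \<Rightarrow> real" where
  "op_norm V T = Inf {C. 0 \<le> C \<and> (\<forall>u \<in> vcarrier V. vnorm V (T u) \<le> C * vnorm V u)}"

definition op_id :: "('v, 'm) normed_sp_scheme \<Rightarrow> 'v \<Rightarrow> 'v" where
  "op_id V = (\<lambda>u \<in> vcarrier V. u)"

definition op_add :: "('v, 'm) normed_sp_scheme \<Rightarrow> ('v \<Rightarrow> 'v) \<Rightarrow> ('v \<Rightarrow> 'v) \<Rightarrow> 'v \<Rightarrow> 'v" where
  "op_add V S T = (\<lambda>u \<in> vcarrier V. vadd V (S u) (T u))"

definition op_scale :: "('v, 'm) normed_sp_scheme \<Rightarrow> complex \<Rightarrow> ('v \<Rightarrow> 'v) \<Rightarrow> 'v \<Rightarrow> 'v" where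
  "op_scale V c T = (\<lambda>u \<in> vcarrier V. vscale V c (T u))"

definition op_diff :: "('v, 'm) normed_sp_scheme \<Rightarrow> ('v \<Rightarrow> 'v) \<Rightarrow> ('v \<Rightarrow> 'v) \<Rightarrow> 'v \<Rightarrow> 'v" where
  "op_diff V S T = op_add V S (op_scale V (-1) T)"

definition op_comp :: "('v, 'm) normed_sp_scheme \<Rightarrow> ('v \<Rightarrow> 'v) \<Rightarrow> ('v \<Rightarrow> 'v) \<Rightarrow> 'v \<Rightarrow> 'v" where
  "op_comp V S T = compose (vcarrier V) S T"

definition is_inverse_op ::
    "('v, 'm) normed_sp_scheme \<Rightarrow> ('v \<Rightarrow> 'v) \<Rightarrow> ('v \<Rightarrow> 'v) \<Rightarrow> bool" where
  "is_inverse_op V A T \<longleftrightarrow>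
     T \<in> bounded_ops V \<and> op_comp V A T = op_id V \<and> op_comp V T A = op_id V"

definition resolvent_set :: "('v, 'm) normed_sp_scheme \<Rightarrow> ('v \<Rightarrow> 'v) \<Rightarrow> complex set" where
  "resolvent_set V A = {z. \<exists>T. is_inverse_op V (op_diff V (op_scale V z (op_id V)) A) T}"

text \<open>\<open>1/(z - A)\<close>; meaningful for \<open>z\<close> in the resolvent set.\<close>

definition resolvent :: "('v, 'm) normed_sp_scheme \<Rightarrow> ('v \<Rightarrow> 'v) \<Rightarrow> complex \<Rightarrow> 'v \<Rightarrow> 'v" where
  "resolvent V A z = (THE T. is_inverse_op V (op_diff V (op_scale V z (op_id V)) A) T)"

text \<open>Integrals of operator-valued functions over the plane are taken in the weak operator sense.
  An integral in operator norm is not available for \<open>\<phi>(z)/(z - \<Omega>)\<close>: the norm of the resolvent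
  may grow like \<open>1/|Im z|\<close>, which is not integrable.\<close>

definition has_op_integral ::
    "('v, 'm) hilbert_sp_scheme \<Rightarrow> complex set \<Rightarrow> (complex \<Rightarrow> 'v \<Rightarrow> 'v) \<Rightarrow> ('v \<Rightarrow> 'v) \<Rightarrow> bool" where
  "has_op_integral V A F T \<longleftrightarrow> T \<in> bounded_ops V \<and>
     (\<forall>u \<in> vcarrier V. \<forall>v \<in> vcarrier V.
        set_integrable lborel A (\<lambda>z. vinner V (F z u) v) \<and>
        set_lebesgue_integral lborel A (\<lambda>z. vinner V (F z u) v) = vinner V (T u) v)"

definition op_integrable ::
    "('v, 'm) hilbert_sp_scheme \<Rightarrow> complex set \<Rightarrow> (complex \<Rightarrow> 'v \<Rightarrow> 'v) \<Rightarrow> bool" where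
  "op_integrable V A F \<longleftrightarrow> (\<exists>T. has_op_integral V A F T)"

definition op_integral ::
    "('v, 'm) hilbert_sp_scheme \<Rightarrow> complex set \<Rightarrow> (complex \<Rightarrow> 'v \<Rightarrow> 'v) \<Rightarrow> 'v \<Rightarrow> 'v" where
  "op_integral V A F = (THE T. has_op_integral V A F T)"

section \<open>Operator-valued distributions on the complex plane\<close>

definition op_distribution ::
    "('v, 'm) normed_sp_scheme \<Rightarrow> ((complex \<Rightarrow> complex) \<Rightarrow> 'v \<Rightarrow> 'v) \<Rightarrow> bool" where
  "op_distribution V R \<longleftrightarrow>
     (\<forall>\<phi> \<in> test_functions. R \<phi> \<in> bounded_ops V) \<and>
     (\<forall>\<phi> \<in> test_functions. \<forall>\<psi> \<in> test_functions.
        R (\<lambda>z. \<phi> z + \<psi> z) = op_add V (R \<phi>) (R \<psi>)) \<and>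
     (\<forall>c. \<forall>\<phi> \<in> test_functions. R (\<lambda>z. c * \<phi> z) = op_scale V c (R \<phi>)) \<and>
     (\<forall>K. compact K \<longrightarrow> (\<exists>C N. \<forall>\<phi> \<in> test_functions. fsupport \<phi> \<subseteq> K \<longrightarrow>
        op_norm V (R \<phi>) \<le> C * test_seminorm N \<phi>))"

text \<open>\<open>\<integral> d\<^sup>2z R(z) \<psi>(z)\<close> is the usual notation for \<open>R(\<psi>)\<close>.\<close>

definition distribution_resolvent_equation ::
    "('v, 'm) normed_sp_scheme \<Rightarrow> ((complex \<Rightarrow> complex) \<Rightarrow> 'v \<Rightarrow> 'v) \<Rightarrow> bool" where
  "distribution_resolvent_equation V R \<longleftrightarrow>
     (\<forall>\<phi>\<^sub>1 \<in> test_functions. \<forall>\<phi>\<^sub>2 \<in> test_functions.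
        op_comp V (R \<phi>\<^sub>1) (R \<phi>\<^sub>2) =
          op_diff V (R (\<lambda>z\<^sub>1. \<phi>\<^sub>1 z\<^sub>1 * (LINT z\<^sub>2|lborel. \<phi>\<^sub>2 z\<^sub>2 / (z\<^sub>2 - z\<^sub>1))))
                    (R (\<lambda>z\<^sub>2. \<phi>\<^sub>2 z\<^sub>2 * (LINT z\<^sub>1|lborel. \<phi>\<^sub>1 z\<^sub>1 / (z\<^sub>2 - z\<^sub>1)))))"

definition distr_dbar ::
    "('v, 'm) normed_sp_scheme \<Rightarrow> ((complex \<Rightarrow> complex) \<Rightarrow> 'v \<Rightarrow> 'v) \<Rightarrow>
       (complex \<Rightarrow> complex) \<Rightarrow> 'v \<Rightarrow> 'v" where
  "distr_dbar V T \<phi> = op_scale V (-1) (T (dbar \<phi>))"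

definition spectral_distribution ::
    "('v, 'm) normed_sp_scheme \<Rightarrow> ((complex \<Rightarrow> complex) \<Rightarrow> 'v \<Rightarrow> 'v) \<Rightarrow>
       (complex \<Rightarrow> complex) \<Rightarrow> 'v \<Rightarrow> 'v" where
  "spectral_distribution V R \<phi> = op_scale V (complex_of_real (1 / pi)) (distr_dbar V R \<phi>)"

section \<open>The Hilbert space \<open>L\<^sup>2(G)\<close>\<close>

definition L2_functions :: "'a::euclidean_space set \<Rightarrow> ('a \<Rightarrow> complex) set" where
  "L2_functions G = {f. f \<in> borel_measurable (lebesgue_on G) \<and>
     integrable (lebesgue_on G) (\<lambda>y. (cmod (f y))\<^sup>2)}"

definition L2_rel :: "'a::euclidean_space set \<Rightarrow> (('a \<Rightarrow> complex) \<times> ('a \<Rightarrow> complex)) set" where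
  "L2_rel G = {(f, g). f \<in> L2_functions G \<and> g \<in> L2_functions G \<and>
     (AE y in lebesgue_on G. f y = g y)}"

definition L2_class :: "'a::euclidean_space set \<Rightarrow> ('a \<Rightarrow> complex) \<Rightarrow> ('a \<Rightarrow> complex) set" where
  "L2_class G f = L2_rel G `` {f}"

definition L2_rep :: "('a::euclidean_space \<Rightarrow> complex) set \<Rightarrow> 'a \<Rightarrow> complex" where
  "L2_rep u = (SOME f. f \<in> u)"

definition L2_inner ::
    "'a::euclidean_space set \<Rightarrow> ('a \<Rightarrow> complex) set \<Rightarrow> ('a \<Rightarrow> complex) set \<Rightarrow> complex" where
  "L2_inner G u v = (LINT y|lebesgue_on G. L2_rep u y * cnj (L2_rep v y))"

definition L2 :: "'a::euclidean_space set \<Rightarrow> ('a \<Rightarrow> complex) set hilbert_sp" where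
  "L2 G = \<lparr> vcarrier = L2_functions G // L2_rel G,
            vadd = (\<lambda>u v. L2_class G (\<lambda>y. L2_rep u y + L2_rep v y)),
            vscale = (\<lambda>c u. L2_class G (\<lambda>y. c * L2_rep u y)),
            vnorm = (\<lambda>u. sqrt (LINT y|lebesgue_on G. (cmod (L2_rep u y))\<^sup>2)),
            vinner = L2_inner G \<rparr>"

definition L2_mult ::
    "'a::euclidean_space set \<Rightarrow> ('a \<Rightarrow> complex) \<Rightarrow> ('a \<Rightarrow> complex) set \<Rightarrow> ('a \<Rightarrow> complex) set" where
  "L2_mult G m = (\<lambda>u \<in> vcarrier (L2 G). L2_class G (\<lambda>y. m y * L2_rep u y))"

definition resolvent_distribution ::
    "'a::euclidean_space set \<Rightarrow> (('a \<Rightarrow> complex) set \<Rightarrow> ('a \<Rightarrow> complex) set) \<Rightarrow>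
       (complex \<Rightarrow> complex) \<Rightarrow> ('a \<Rightarrow> complex) set \<Rightarrow> ('a \<Rightarrow> complex) set" where
  "resolvent_distribution G A \<phi> =
     op_integral (L2 G) {z. Im z \<noteq> 0} (\<lambda>z. op_scale (L2 G) (\<phi> z) (resolvent (L2 G) A z))"

end

theory Submission
  imports Defs
begin

text \<open>Let \<open>C\<phi>(p) = \<integral> d\<^sup>2z \<phi>(z)/(z - p)\<close> be the Cauchy transform. Since \<open>1/\<bar>z\<bar>\<close> is locally integrable in the
  plane, \<open>C\<phi>\<close> is bounded in terms of the supremum and the support of \<open>\<phi>\<close>, and by Fubini
  \<open>R(\<phi>)\<close> is multiplication by \<open>C\<phi> \<circ> P\<close>. The resolvent equation then reduces to
  \<open>C\<phi> C\<psi> = C(\<phi> C\<psi>) + C(\<psi> C\<phi>)\<close>, which is the partial fraction identity integrated, and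
  the formula for the spectral distribution to the Cauchy-Pompeiu formula
  \<open>C(dbar \<phi>) = - \<pi> \<phi>\<close>.\<close>

section \<open>The Cauchy transform\<close>

text \<open>Everything rests on one estimate: the integral of |\<phi>(z)|/|z - p| over the plane has
  a bound that does not depend on \<open>p\<close>. The norm of \<open>1/(z - \<Omega>)\<close> may
  grow like 1/|Im z|, but after pairing with two vectors the plane is integrated over first, with y
  fixed, and this growth never enters. The same uniform bound makes the iterated kernel of the
  product formula absolutely integrable, makes the symbol of \<open>R(\<phi>)\<close> bounded, and
  gives a seminorm estimate of order zero. The map from bounded symbols to multiplication operators
  respects all algebraic operations, so each operator identity is a scalar identity in p, evaluated
  at p = P(y). Signs: the second inner integral of the resolvent equation is minus a Cauchy
  transform, which turns the difference into a sum; the minus in C(dbar \<phi>) = -pi \<phi> cancels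
  the one in the definition of the distributional derivative. The constant pi is the total mass of
  1/(|w|^2 + 1)^2, the profile of the dbar-derivative of a smoothed 1/w.\<close>

lemma measurable_Complex [measurable]: "(\<lambda>(x, y). Complex x y) \<in> borel_measurable (borel \<Otimes>\<^sub>M borel)"
  unfolding borel_prod
  by (intro borel_measurable_continuous_onI) (auto simp: case_prod_unfold Complex_eq intro!: continuous_intros)

text \<open>Lebesgue measure is determined by its values on boxes, and a box in the plane pulls back
  to a rectangle. This gives Tonelli in Cartesian coordinates.\<close>

lemma lborel_complex_eq:
  "(lborel :: complex measure) = distr (lborel \<Otimes>\<^sub>M lborel) borel (\<lambda>(x, y). Complex x y)"
proof (rule lborel_eqI)
  fix l u :: complex assume le: "\<And>b. b \<in> Basis \<Longrightarrow> l \<bullet> b \<le> u \<bullet> b"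
  have le': "Re l \<le> Re u" "Im l \<le> Im u"
    using le[of 1] le[of \<i>] by (auto simp: Basis_complex_def inner_complex_def)
  have vimage: "(\<lambda>(x, y). Complex x y) -` box l u \<inter> space (lborel \<Otimes>\<^sub>M lborel) =
      {Re l<..<Re u} \<times> {Im l<..<Im u}"
    by (auto simp: mem_box Basis_complex_def inner_complex_def space_pair_measure)
  have "emeasure (distr (lborel \<Otimes>\<^sub>M lborel) borel (\<lambda>(x, y). Complex x y)) (box l u) =
      emeasure (lborel \<Otimes>\<^sub>M lborel) ({Re l<..<Re u} \<times> {Im l<..<Im u})"
    by (subst emeasure_distr) (use vimage in auto)
  also have "\<dots> = ennreal (Re u - Re l) * ennreal (Im u - Im l)"
    using le' by (subst lborel.emeasure_pair_measure_Times) auto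
  also have "\<dots> = ennreal (\<Prod>b\<in>Basis. (u - l) \<bullet> b)"
    using le' by (simp add: Basis_complex_def inner_complex_def ennreal_mult)
  finally show "emeasure (distr (lborel \<Otimes>\<^sub>M lborel) borel (\<lambda>(x, y). Complex x y)) (box l u) =
    ennreal (\<Prod>b\<in>Basis. (u - l) \<bullet> b)" .
qed simp

lemma nn_integral_lborel_complex:
  assumes [measurable]: "f \<in> borel_measurable (borel :: complex measure)"
  shows "(\<integral>\<^sup>+z. f z \<partial>lborel) = (\<integral>\<^sup>+x. \<integral>\<^sup>+y. f (Complex x y) \<partial>lborel \<partial>lborel)"
proof -
  have "(\<integral>\<^sup>+z. f z \<partial>lborel) = (\<integral>\<^sup>+p. f (case p of (x, y) \<Rightarrow> Complex x y) \<partial>(lborel \<Otimes>\<^sub>M lborel))"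
    by (subst lborel_complex_eq, subst nn_integral_distr) auto
  also have "\<dots> = (\<integral>\<^sup>+x. \<integral>\<^sup>+y. f (Complex x y) \<partial>lborel \<partial>lborel)"
    by (subst lborel.nn_integral_fst[symmetric]) auto
  finally show ?thesis .
qed

text \<open>The exponent -1/2 is half of the singularity of 1/|z|: each coordinate takes one half.
  Reflection reduces to the interval from 0 to 1, where the integral is 2.\<close>

lemma nn_integral_inverse_sqrt_abs_finite:
  "(\<integral>\<^sup>+x. ennreal (indicator {-1..1} x * \<bar>x\<bar> powr (-1/2)) \<partial>lborel) < \<infinity>"
proof -
  define h :: "real \<Rightarrow> real" where "h x = indicator {0..1} x * x powr (-1/2)" for x
  have [measurable]: "h \<in> borel_measurable borel" unfolding h_def by simp
  have "(h has_integral 2) UNIV"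
  proof -
    have "h = (\<lambda>x. if x \<in> {0..1} then x powr (-1/2) else 0)"
      by (auto simp: h_def indicator_def)
    then show ?thesis
      using has_integral_powr_from_0[of "-1/2" 1] by (simp only: has_integral_restrict_UNIV) simp
  qed
  then have h2: "(\<integral>\<^sup>+x. ennreal (h x) \<partial>lborel) = 2"
    by (subst nn_integral_has_integral_lborel) (auto simp: h_def)
  have "(\<integral>\<^sup>+x. ennreal (indicator {-1..1} x * \<bar>x\<bar> powr (-1/2)) \<partial>lborel)
      \<le> (\<integral>\<^sup>+x. ennreal (h x) + ennreal (h (- x)) \<partial>lborel)"
    by (intro nn_integral_mono) (auto simp: h_def indicator_def)
  also have "\<dots> = (\<integral>\<^sup>+x. ennreal (h x) \<partial>lborel) + (\<integral>\<^sup>+x. ennreal (h (- x)) \<partial>lborel)"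
    by (intro nn_integral_add) auto
  also have "(\<integral>\<^sup>+x. ennreal (h (- x)) \<partial>lborel) = (\<integral>\<^sup>+x. ennreal (h x) \<partial>lborel)"
    by (subst (2) nn_integral_real_affine[of _ "-1" 0]) auto
  finally show ?thesis unfolding h2 by (rule le_less_trans) simp
qed

text \<open>The bound \<open>\<bar>x\<bar>\<bar>y\<bar> \<le> \<bar>x + i y\<bar>\<^sup>2\<close> separates the variables, so that no polar coordinates
  are needed.\<close>

lemma nn_integral_cauchy_kernel_box_finite:
  "(\<integral>\<^sup>+z. ennreal (indicator {z. \<bar>Re z\<bar> \<le> 1 \<and> \<bar>Im z\<bar> \<le> 1} z / cmod z) \<partial>lborel) < \<infinity>"
proof -
  define g :: "real \<Rightarrow> real" where "g x = indicator {-1..1} x * \<bar>x\<bar> powr (-1/2)" for x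
  have [measurable]: "g \<in> borel_measurable borel" unfolding g_def by simp
  have g0: "0 \<le> g x" for x by (simp add: g_def)
  \<comment> \<open>The axes are excluded because \<open>0 powr a = 0\<close> makes \<open>g\<close>
    vanish at 0, where the estimate would fail; they are null sets.\<close>
  have le: "indicator {z. \<bar>Re z\<bar> \<le> 1 \<and> \<bar>Im z\<bar> \<le> 1} (Complex x y) / cmod (Complex x y) \<le> g x * g y"
    if "x \<noteq> 0" "y \<noteq> 0" for x y
  proof (cases "\<bar>x\<bar> \<le> 1 \<and> \<bar>y\<bar> \<le> 1")
    case True
    have "\<bar>x\<bar> * \<bar>y\<bar> \<le> x\<^sup>2 + y\<^sup>2"
    proof -
      have "0 \<le> (\<bar>x\<bar> - \<bar>y\<bar>)\<^sup>2" by simp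
      then have "2 * (\<bar>x\<bar> * \<bar>y\<bar>) \<le> x\<^sup>2 + y\<^sup>2" by (simp add: power2_diff)
      moreover have "0 \<le> \<bar>x\<bar> * \<bar>y\<bar>" by simp
      ultimately show ?thesis by linarith
    qed
    then have "sqrt (\<bar>x\<bar> * \<bar>y\<bar>) \<le> cmod (Complex x y)"
      by (simp add: complex_norm)
    moreover have "0 < sqrt (\<bar>x\<bar> * \<bar>y\<bar>)" using that by simp
    ultimately have "1 / cmod (Complex x y) \<le> 1 / sqrt (\<bar>x\<bar> * \<bar>y\<bar>)"
      by (intro divide_left_mono mult_pos_pos) auto
    also have "\<dots> = g x * g y" using True that
      by (auto simp: g_def indicator_def powr_minus_divide powr_half_sqrt real_sqrt_mult)
    finally show ?thesis using True by (simp add: indicator_def)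
  next
    case False
    then show ?thesis using g0 by auto
  qed
  have "(\<integral>\<^sup>+z. ennreal (indicator {z. \<bar>Re z\<bar> \<le> 1 \<and> \<bar>Im z\<bar> \<le> 1} z / cmod z) \<partial>lborel) =
    (\<integral>\<^sup>+x. \<integral>\<^sup>+y. ennreal (indicator {z. \<bar>Re z\<bar> \<le> 1 \<and> \<bar>Im z\<bar> \<le> 1} (Complex x y) / cmod (Complex x y))
      \<partial>lborel \<partial>lborel)"
    by (intro nn_integral_lborel_complex) simp
  also have "\<dots> \<le> (\<integral>\<^sup>+x. \<integral>\<^sup>+y. ennreal (g x) * ennreal (g y) \<partial>lborel \<partial>lborel)"
  proof (intro nn_integral_mono_AE)
    show "AE x in lborel. (\<integral>\<^sup>+y. ennreal (indicator {z. \<bar>Re z\<bar> \<le> 1 \<and> \<bar>Im z\<bar> \<le> 1} (Complex x y) /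
        cmod (Complex x y)) \<partial>lborel) \<le> (\<integral>\<^sup>+y. ennreal (g x) * ennreal (g y) \<partial>lborel)"
      using AE_lborel_singleton[of "0::real"]
    proof eventually_elim
      case (elim x)
      show ?case
      proof (intro nn_integral_mono_AE)
        show "AE y in lborel. ennreal (indicator {z. \<bar>Re z\<bar> \<le> 1 \<and> \<bar>Im z\<bar> \<le> 1} (Complex x y) /
          cmod (Complex x y)) \<le> ennreal (g x) * ennreal (g y)"
          using AE_lborel_singleton[of "0::real"]
          by eventually_elim (use le elim g0 in \<open>simp add: ennreal_mult[symmetric] ennreal_leI\<close>)
      qed
    qed
  qed
  also have "\<dots> = (\<integral>\<^sup>+x. ennreal (g x) \<partial>lborel) * (\<integral>\<^sup>+x. ennreal (g x) \<partial>lborel)"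
    by (simp add: nn_integral_cmult nn_integral_multc)
  also have "\<dots> < \<infinity>"
    using nn_integral_inverse_sqrt_abs_finite unfolding g_def[symmetric]
    by (simp add: ennreal_mult_less_top)
  finally show ?thesis .
qed

lemma nn_integral_lborel_translate:
  fixes f :: "'a::euclidean_space \<Rightarrow> ennreal"
  assumes [measurable]: "f \<in> borel_measurable borel"
  shows "(\<integral>\<^sup>+x. f (c + x) \<partial>lborel) = (\<integral>\<^sup>+x. f x \<partial>lborel)"
  by (subst lborel_distr_plus[of c, symmetric], subst nn_integral_distr) auto

text \<open>Split at the square of half-width 1 around \<open>p\<close>. Inside it, translation
  invariance gives a constant \<open>A\<close> that does not depend on \<open>p\<close>; outside it
  the kernel is at most 1 and contributes at most the area of \<open>S\<close>.\<close>

lemma nn_integral_cauchy_kernel_bound: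
  obtains A where "0 \<le> A"
    "\<And>p S. S \<in> sets borel \<Longrightarrow> emeasure lborel S < \<infinity> \<Longrightarrow>
       (\<integral>\<^sup>+z. ennreal (indicator S z / cmod (z - p)) \<partial>lborel) \<le> ennreal (A + measure lborel S)"
proof -
  define Q where "Q = {z. \<bar>Re z\<bar> \<le> 1 \<and> \<bar>Im z\<bar> \<le> 1}"
  have [measurable]: "Q \<in> sets borel" unfolding Q_def by measurable
  define A where "A = enn2real (\<integral>\<^sup>+z. ennreal (indicator Q z / cmod z) \<partial>lborel)"
  have A: "(\<integral>\<^sup>+z. ennreal (indicator Q z / cmod z) \<partial>lborel) = ennreal A"
    using nn_integral_cauchy_kernel_box_finite by (simp add: A_def Q_def)
  have A0: "0 \<le> A" by (simp add: A_def)
  have "(\<integral>\<^sup>+z. ennreal (indicator S z / cmod (z - p)) \<partial>lborel) \<le> ennreal (A + measure lborel S)"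
    if S[measurable]: "S \<in> sets borel" and fin: "emeasure lborel S < \<infinity>" for S p
  proof -
    have pt: "indicator S z / cmod (z - p) \<le> indicator Q (z - p) / cmod (z - p) + indicator S z" for z
    proof (cases "z - p \<in> Q")
      case False
      then have "1 \<le> cmod (z - p)"
        unfolding Q_def using abs_Re_le_cmod[of "z - p"] abs_Im_le_cmod[of "z - p"] by auto
      then show ?thesis by (auto simp: indicator_def divide_simps)
    qed (auto simp: indicator_def)
    have "(\<integral>\<^sup>+z. ennreal (indicator S z / cmod (z - p)) \<partial>lborel) \<le>
        (\<integral>\<^sup>+z. ennreal (indicator Q (z - p) / cmod (z - p)) + indicator S z \<partial>lborel)"
    proof (intro nn_integral_mono)
      fix z
      show "ennreal (indicator S z / cmod (z - p)) \<le>
          ennreal (indicator Q (z - p) / cmod (z - p)) + indicator S z"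
        using ennreal_leI[OF pt[of z]]
        by (subst (asm) ennreal_plus) (auto simp: ennreal_indicator)
    qed
    also have "\<dots> = (\<integral>\<^sup>+z. ennreal (indicator Q (z - p) / cmod (z - p)) \<partial>lborel) + emeasure lborel S"
      by (subst nn_integral_add) (auto simp: indicator_def)
    also have "(\<integral>\<^sup>+z. ennreal (indicator Q (z - p) / cmod (z - p)) \<partial>lborel) = ennreal A"
      using nn_integral_lborel_translate[of "\<lambda>z. ennreal (indicator Q z / cmod z)" "-p"] A
      by (simp add: add.commute)
    also have "ennreal A + emeasure lborel S = ennreal (A + measure lborel S)"
      using fin A0 by (simp add: emeasure_eq_ennreal_measure)
    finally show ?thesis .
  qed
  with A0 that show ?thesis by blast
qed

text \<open>The resolvent equation evaluates \<open>R\<close> at products \<open>\<phi> C\<psi>\<close>; working with bounded Borel functions of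
  bounded support makes smoothness of \<open>C\<psi>\<close> irrelevant.\<close>

definition cs_bounded :: "(complex \<Rightarrow> complex) \<Rightarrow> bool" where
  "cs_bounded \<phi> \<longleftrightarrow> \<phi> \<in> borel_measurable borel \<and> bounded (range \<phi>) \<and> bounded {z. \<phi> z \<noteq> 0}"

text \<open>The kernel has the sign of the resolvent, with \<open>p\<close> in the place of the
  symbol, and no normalizing factor; hence the factor -pi in \<open>cauchy_pompeiu\<close>.\<close>

definition cauchy_transform :: "(complex \<Rightarrow> complex) \<Rightarrow> complex \<Rightarrow> complex" where
  "cauchy_transform \<phi> p = (LINT z|lborel. \<phi> z / (z - p))"

section \<open>Bounded Borel functions of bounded support and uniform bounds for their Cauchy
  transforms\<close>

lemma cs_bounded_measurable: "cs_bounded \<phi> \<Longrightarrow> \<phi> \<in> borel_measurable borel"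
  by (simp add: cs_bounded_def)

lemma cs_bounded_mult:
  assumes "cs_bounded \<phi>" "g \<in> borel_measurable borel" "bounded (range g)"
  shows "cs_bounded (\<lambda>z. \<phi> z * g z)"
proof -
  obtain a b where ab: "\<And>z. cmod (\<phi> z) \<le> a" "\<And>z. cmod (g z) \<le> b"
    using assms unfolding cs_bounded_def bounded_iff by auto
  have "cmod (\<phi> z * g z) \<le> a * b" for z
    unfolding norm_mult using ab[of z] order_trans[OF norm_ge_zero ab(1)[of z]]
    by (intro mult_mono) auto
  then have "bounded (range (\<lambda>z. \<phi> z * g z))"
    by (auto intro!: boundedI)
  moreover have "bounded {z. \<phi> z * g z \<noteq> 0}"
    by (rule bounded_subset[of "{z. \<phi> z \<noteq> 0}"]) (use assms in \<open>auto simp: cs_bounded_def\<close>)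
  ultimately show ?thesis
    using assms unfolding cs_bounded_def by auto
qed

lemma cs_bounded_cmult: "cs_bounded \<phi> \<Longrightarrow> cs_bounded (\<lambda>z. c * \<phi> z)"
  using cs_bounded_mult[of \<phi> "\<lambda>_. c"] by (simp add: mult.commute)

lemma cs_bounded_add:
  assumes "cs_bounded \<phi>" "cs_bounded \<psi>"
  shows "cs_bounded (\<lambda>z. \<phi> z + \<psi> z)"
proof -
  obtain a b where ab: "\<And>z. cmod (\<phi> z) \<le> a" "\<And>z. cmod (\<psi> z) \<le> b"
    using assms unfolding cs_bounded_def bounded_iff by auto
  have "cmod (\<phi> z + \<psi> z) \<le> a + b" for z
    using ab[of z] by (intro norm_triangle_mono)
  then have "bounded (range (\<lambda>z. \<phi> z + \<psi> z))"
    by (auto intro!: boundedI)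
  moreover have "bounded {z. \<phi> z + \<psi> z \<noteq> 0}"
    by (rule bounded_subset[of "{z. \<phi> z \<noteq> 0} \<union> {z. \<psi> z \<noteq> 0}"])
       (use assms in \<open>auto simp: cs_bounded_def\<close>)
  ultimately show ?thesis
    using assms unfolding cs_bounded_def by auto
qed

text \<open>\<open>A\<close> is chosen before \<open>\<phi>\<close>, \<open>S\<close>,
  \<open>B\<close> and \<open>p\<close>. The continuity estimate in
  \<open>op_distribution_resolvent\<close> relies on this order: its constant may depend on the
  compact set only.\<close>

lemma cauchy_integrand_bound:
  obtains A where "0 \<le> A"
    "\<And>\<phi> S B p. \<phi> \<in> borel_measurable borel \<Longrightarrow> S \<in> sets borel \<Longrightarrow> emeasure lborel S < \<infinity> \<Longrightarrow>
       (\<And>z. cmod (\<phi> z) \<le> B) \<Longrightarrow> {z. \<phi> z \<noteq> 0} \<subseteq> S \<Longrightarrow>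
       (\<integral>\<^sup>+z. ennreal (cmod (\<phi> z / (z - p))) \<partial>lborel) \<le> ennreal (B * (A + measure lborel S))"
proof -
  obtain A where A: "0 \<le> A"
    "\<And>p S. S \<in> sets borel \<Longrightarrow> emeasure lborel S < \<infinity> \<Longrightarrow>
       (\<integral>\<^sup>+z. ennreal (indicator S z / cmod (z - p)) \<partial>lborel) \<le> ennreal (A + measure lborel S)"
    using nn_integral_cauchy_kernel_bound by blast
  show ?thesis
  proof (rule that[OF A(1)])
    fix \<phi> :: "complex \<Rightarrow> complex" and S B and p :: complex
    assume [measurable]: "\<phi> \<in> borel_measurable borel" "S \<in> sets borel"
      and fin: "emeasure lborel S < \<infinity>" and B: "\<And>z. cmod (\<phi> z) \<le> B" and S: "{z. \<phi> z \<noteq> 0} \<subseteq> S"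
    have B0: "0 \<le> B" using B[of 0] norm_ge_zero order_trans by blast
    have pt: "cmod (\<phi> z / (z - p)) \<le> B * (indicator S z / cmod (z - p))" for z
    proof (cases "z \<in> S")
      case False
      then have "\<phi> z = 0" using S by auto
      then show ?thesis using B0 by simp
    qed (use B[of z] in \<open>simp add: norm_divide divide_right_mono\<close>)
    have "(\<integral>\<^sup>+z. ennreal (cmod (\<phi> z / (z - p))) \<partial>lborel) \<le>
        (\<integral>\<^sup>+z. ennreal B * ennreal (indicator S z / cmod (z - p)) \<partial>lborel)"
      by (intro nn_integral_mono) (use pt B0 in \<open>simp add: ennreal_mult[symmetric] ennreal_leI\<close>)
    also have "\<dots> = ennreal B * (\<integral>\<^sup>+z. ennreal (indicator S z / cmod (z - p)) \<partial>lborel)"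
      by (intro nn_integral_cmult) simp
    also have "\<dots> \<le> ennreal B * ennreal (A + measure lborel S)"
      by (intro mult_left_mono A(2) fin) auto
    also have "\<dots> = ennreal (B * (A + measure lborel S))"
      using B0 A(1) by (simp add: ennreal_mult)
    finally show "(\<integral>\<^sup>+z. ennreal (cmod (\<phi> z / (z - p))) \<partial>lborel) \<le> ennreal (B * (A + measure lborel S))" .
  qed
qed

lemma cs_bounded_cauchy_bound:
  assumes "cs_bounded \<phi>"
  obtains C where "0 \<le> C"
    "\<And>p. (\<integral>\<^sup>+z. ennreal (cmod (\<phi> z / (z - p))) \<partial>lborel) \<le> ennreal C"
proof -
  obtain B r where B: "\<And>z. cmod (\<phi> z) \<le> B" and r: "{z. \<phi> z \<noteq> 0} \<subseteq> cball 0 r"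
    using assms unfolding cs_bounded_def bounded_iff by (auto simp: subset_iff)
  have B0: "0 \<le> B" using B[of 0] norm_ge_zero order_trans by blast
  obtain A where "0 \<le> A"
    "\<And>\<phi> S B p. \<phi> \<in> borel_measurable borel \<Longrightarrow> S \<in> sets borel \<Longrightarrow> emeasure lborel S < \<infinity> \<Longrightarrow>
       (\<And>z. cmod (\<phi> z) \<le> B) \<Longrightarrow> {z. \<phi> z \<noteq> 0} \<subseteq> S \<Longrightarrow>
       (\<integral>\<^sup>+z. ennreal (cmod (\<phi> z / (z - p))) \<partial>lborel) \<le> ennreal (B * (A + measure lborel S))"
    using cauchy_integrand_bound by blast
  note A = this
  show ?thesis
  proof (rule that)
    show "(\<integral>\<^sup>+z. ennreal (cmod (\<phi> z / (z - p))) \<partial>lborel) \<le>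
        ennreal (B * (A + measure lborel (cball (0::complex) r)))" for p
      by (rule A(2)) (use B r assms in \<open>auto simp: cs_bounded_def emeasure_lborel_cball_finite[unfolded infinity_ennreal_def]\<close>)
  qed (use A(1) B0 in simp)
qed

lemma cauchy_integrable:
  assumes "cs_bounded \<phi>"
  shows "integrable lborel (\<lambda>z. \<phi> z / (z - p))"
proof -
  obtain C where C: "(\<integral>\<^sup>+z. ennreal (cmod (\<phi> z / (z - p))) \<partial>lborel) \<le> ennreal C"
    using cs_bounded_cauchy_bound[OF assms] by blast
  show ?thesis using assms C
    by (intro integrableI_bounded) (auto simp: cs_bounded_def intro: le_less_trans)
qed

lemma norm_cauchy_transform_le:
  assumes "cs_bounded \<phi>" "(\<integral>\<^sup>+z. ennreal (cmod (\<phi> z / (z - p))) \<partial>lborel) \<le> ennreal C" "0 \<le> C"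
  shows "cmod (cauchy_transform \<phi> p) \<le> C"
proof -
  have "ennreal (cmod (cauchy_transform \<phi> p)) \<le> ennreal C"
    unfolding cauchy_transform_def
    using integral_norm_bound_ennreal[OF cauchy_integrable[OF assms(1)]] assms(2) by (rule order_trans)
  with assms(3) show ?thesis by simp
qed

lemma bounded_cauchy_transform:
  assumes "cs_bounded \<phi>" shows "bounded (range (cauchy_transform \<phi>))"
  by (rule cs_bounded_cauchy_bound[OF assms])
     (auto intro!: boundedI norm_cauchy_transform_le[OF assms])

lemma measurable_cauchy_transform:
  assumes "cs_bounded \<phi>" shows "cauchy_transform \<phi> \<in> borel_measurable borel"
proof -
  have [measurable]: "\<phi> \<in> borel_measurable borel" using assms by (simp add: cs_bounded_def)
  show ?thesis unfolding cauchy_transform_def[abs_def]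
    by (intro lborel.borel_measurable_lebesgue_integral) (auto simp: case_prod_unfold)
qed

lemma cauchy_transform_cmult:
  "cauchy_transform (\<lambda>z. c * \<phi> z) p = c * cauchy_transform \<phi> p"
  by (simp add: cauchy_transform_def mult.assoc flip: times_divide_eq_right)

lemma cauchy_transform_add:
  assumes "cs_bounded \<phi>" "cs_bounded \<psi>"
  shows "cauchy_transform (\<lambda>z. \<phi> z + \<psi> z) p = cauchy_transform \<phi> p + cauchy_transform \<psi> p"
  using assms by (simp add: cauchy_transform_def add_divide_distrib cauchy_integrable)

text \<open>Tonelli with \<open>w\<close> innermost. The pole of the inner kernel is the outer
  variable \<open>z\<close>, so the uniformity of \<open>D\<close> in the position of the pole is
  what lets the inner integral be pulled out.\<close>

lemma integrable_iterated_cauchy_kernel: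
  assumes "cs_bounded \<phi>" "cs_bounded \<psi>"
  shows "integrable (lborel \<Otimes>\<^sub>M lborel) (\<lambda>(z, w). \<phi> z / (z - p) * (\<psi> w / (w - z)))"
proof -
  have [measurable]: "\<phi> \<in> borel_measurable borel" "\<psi> \<in> borel_measurable borel"
    using assms by (simp_all add: cs_bounded_def)
  obtain C where C: "0 \<le> C"
    "\<And>p. (\<integral>\<^sup>+z. ennreal (cmod (\<phi> z / (z - p))) \<partial>lborel) \<le> ennreal C"
    using cs_bounded_cauchy_bound[OF assms(1)] by blast
  obtain D where D: "0 \<le> D"
    "\<And>p. (\<integral>\<^sup>+z. ennreal (cmod (\<psi> z / (z - p))) \<partial>lborel) \<le> ennreal D"
    using cs_bounded_cauchy_bound[OF assms(2)] by blast
  have "(\<integral>\<^sup>+x. ennreal (norm (case x of (z, w) \<Rightarrow> \<phi> z / (z - p) * (\<psi> w / (w - z)))) \<partial>(lborel \<Otimes>\<^sub>M lborel)) =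
      (\<integral>\<^sup>+z. \<integral>\<^sup>+w. ennreal (norm (\<phi> z / (z - p) * (\<psi> w / (w - z)))) \<partial>lborel \<partial>lborel)"
    by (subst lborel.nn_integral_fst[symmetric]) (auto simp: case_prod_unfold)
  also have "\<dots> = (\<integral>\<^sup>+z. \<integral>\<^sup>+w. ennreal (cmod (\<phi> z / (z - p))) * ennreal (cmod (\<psi> w / (w - z)))
      \<partial>lborel \<partial>lborel)"
    by (simp only: norm_mult ennreal_mult norm_ge_zero)
  also have "\<dots> = (\<integral>\<^sup>+z. ennreal (cmod (\<phi> z / (z - p))) *
      (\<integral>\<^sup>+w. ennreal (cmod (\<psi> w / (w - z))) \<partial>lborel) \<partial>lborel)"
    by (intro nn_integral_cong nn_integral_cmult) simp
  also have "\<dots> \<le> (\<integral>\<^sup>+z. ennreal (cmod (\<phi> z / (z - p))) * ennreal D \<partial>lborel)"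
    by (intro nn_integral_mono mult_left_mono D) auto
  also have "\<dots> = (\<integral>\<^sup>+z. ennreal (cmod (\<phi> z / (z - p))) \<partial>lborel) * ennreal D"
    by (intro nn_integral_multc) simp
  also have "\<dots> \<le> ennreal C * ennreal D"
    by (intro mult_right_mono C) auto
  also have "\<dots> < \<infinity>" by (simp add: ennreal_mult_less_top)
  finally show ?thesis
    by (intro integrableI_bounded) (auto simp: case_prod_unfold)
qed

lemma integral_iterated_cauchy_kernel:
  assumes "cs_bounded \<phi>" "cs_bounded \<psi>"
  shows "(\<integral>(z, w). \<phi> z / (z - p) * (\<psi> w / (w - z)) \<partial>(lborel \<Otimes>\<^sub>M lborel)) =
    cauchy_transform (\<lambda>z. \<phi> z * cauchy_transform \<psi> z) p"
proof -
  have "(\<integral>(z, w). \<phi> z / (z - p) * (\<psi> w / (w - z)) \<partial>(lborel \<Otimes>\<^sub>M lborel)) =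
      (LINT z|lborel. LINT w|lborel. \<phi> z / (z - p) * (\<psi> w / (w - z)))"
    using lborel_pair.integral_fst[OF integrable_iterated_cauchy_kernel[OF assms, of p]] by simp
  also have "\<dots> = (LINT z|lborel. \<phi> z / (z - p) * cauchy_transform \<psi> z)"
    by (simp only: integral_mult_right_zero cauchy_transform_def)
  also have "\<dots> = cauchy_transform (\<lambda>z. \<phi> z * cauchy_transform \<psi> z) p"
    by (simp add: cauchy_transform_def[of "\<lambda>z. \<phi> z * cauchy_transform \<psi> z"])
  finally show ?thesis .
qed

text \<open>Serves the measurability premise of \<open>AE_pair_measure\<close> in the next
  proof.\<close>

lemma sets_Collect_eq_complex:
  fixes f g :: "'a \<Rightarrow> complex"
  assumes "f \<in> borel_measurable M" "g \<in> borel_measurable M"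
  shows "{x \<in> space M. f x = g x} \<in> sets M"
proof -
  have "{x \<in> space M. f x = g x} = (\<lambda>x. f x - g x) -` {0} \<inter> space M" by auto
  also have "\<dots> \<in> sets M" using assms by (intro measurable_sets[of _ M borel]) auto
  finally show ?thesis .
qed

text \<open>Integrate \<open>1/((z - p)(w - p)) = 1/((z - p)(w - z)) + 1/((w - p)(z - w))\<close> against
  \<open>\<phi>(z) \<psi>(w)\<close>.\<close>

lemma cauchy_transform_mult:
  assumes "cs_bounded \<phi>" "cs_bounded \<psi>"
  shows "cauchy_transform \<phi> p * cauchy_transform \<psi> p =
    cauchy_transform (\<lambda>z. \<phi> z * cauchy_transform \<psi> z) p +
    cauchy_transform (\<lambda>z. \<psi> z * cauchy_transform \<phi> z) p"
proof -
  have [measurable]: "\<phi> \<in> borel_measurable borel" "\<psi> \<in> borel_measurable borel"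
    using assms by (simp_all add: cs_bounded_def)
  let ?f = "\<lambda>(z, w). \<phi> z / (z - p) * (\<psi> w / (w - z))"
  let ?g = "\<lambda>(w, z). \<psi> w / (w - p) * (\<phi> z / (z - w))"
  \<comment> \<open>The second kernel with its variables swapped, so that both kernels and
    \<open>?h\<close> are functions of the same pair \<open>(z, w)\<close>.\<close>
  let ?g' = "\<lambda>(z, w). ?g (w, z)"
  let ?h = "\<lambda>(z, w). \<phi> z / (z - p) * (\<psi> w / (w - p))"
  have f: "integrable (lborel \<Otimes>\<^sub>M lborel) ?f" and g: "integrable (lborel \<Otimes>\<^sub>M lborel) ?g"
    by (rule integrable_iterated_cauchy_kernel[OF assms], rule integrable_iterated_cauchy_kernel[OF assms(2,1)])
  have g': "integrable (lborel \<Otimes>\<^sub>M lborel) ?g'"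
    by (rule lborel_pair.integrable_product_swap[OF g])
  have int_g': "integral\<^sup>L (lborel \<Otimes>\<^sub>M lborel) ?g' = integral\<^sup>L (lborel \<Otimes>\<^sub>M lborel) ?g"
    using lborel_pair.integral_product_swap[OF borel_measurable_integrable[OF g]] by simp
  have int_fg: "integrable (lborel \<Otimes>\<^sub>M lborel) (\<lambda>x. ?f x + ?g' x)"
    using f g' by (rule Bochner_Integration.integrable_add)
  have h_meas: "?h \<in> borel_measurable (lborel \<Otimes>\<^sub>M lborel)"
    unfolding case_prod_unfold by measurable
  \<comment> \<open>The identity may fail where \<open>z = p\<close>, \<open>w = p\<close> or
    \<open>w = z\<close>, since \<open>x / 0 = 0\<close>; each exclusion removes a single point per
    section.\<close>
  have AE_eq: "AE x in lborel \<Otimes>\<^sub>M lborel. ?f x + ?g' x = ?h x"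
  proof (rule lborel_pair.AE_pair_measure)
    show "{x \<in> space (lborel \<Otimes>\<^sub>M lborel). ?f x + ?g' x = ?h x} \<in> sets (lborel \<Otimes>\<^sub>M lborel)"
      by (rule sets_Collect_eq_complex[OF borel_measurable_integrable[OF int_fg] h_meas])
    show "AE z in lborel. AE w in lborel. ?f (z, w) + ?g' (z, w) = ?h (z, w)"
      using AE_lborel_singleton[of p]
    proof eventually_elim
      case (elim z)
      show ?case using AE_lborel_singleton[of p] AE_lborel_singleton[of z]
      proof eventually_elim
        case (elim w)
        then have "z - p \<noteq> 0" "w - p \<noteq> 0" "w - z \<noteq> 0" "z - w \<noteq> 0" using \<open>z \<noteq> p\<close> by auto
        \<comment> \<open>Instantiated with \<open>a = z - p\<close>, \<open>b = w - z\<close> and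
          \<open>c = w - p\<close>.\<close>
        moreover have "1 / (a * b) + 1 / (c * - b) = 1 / (a * c)"
          if "c = a + b" "a \<noteq> 0" "b \<noteq> 0" "c \<noteq> 0" for a b c :: complex
        proof -
          have "1 / (a * b) + 1 / (c * - b) = (c - a) / (a * b * c)"
            using that(2-4) by (simp add: diff_divide_distrib mult.commute)
          then show ?thesis using that by simp
        qed
        from this[of "w - p" "z - p" "w - z"] calculation
        have "1 / ((z - p) * (w - z)) + 1 / ((w - p) * (z - w)) = 1 / ((z - p) * (w - p))" by simp
        then have "\<phi> z * \<psi> w * (1 / ((z - p) * (w - z)) + 1 / ((w - p) * (z - w))) =
            \<phi> z * \<psi> w * (1 / ((z - p) * (w - p)))" by simp
        then show ?case by (simp add: distrib_left mult.commute)
      qed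
    qed
  qed
  \<comment> \<open>The integrability of the product kernel is inherited from the two iterated
    kernels.\<close>
  have h: "integrable (lborel \<Otimes>\<^sub>M lborel) ?h"
    by (rule integrable_cong_AE_imp[OF int_fg h_meas AE_eq])
  have eq: "integral\<^sup>L (lborel \<Otimes>\<^sub>M lborel) (\<lambda>x. ?f x + ?g' x) = integral\<^sup>L (lborel \<Otimes>\<^sub>M lborel) ?h"
    by (rule integral_cong_AE[OF borel_measurable_integrable[OF int_fg] h_meas AE_eq])
  have "integral\<^sup>L (lborel \<Otimes>\<^sub>M lborel) ?h = cauchy_transform \<phi> p * cauchy_transform \<psi> p"
  proof -
    have "integral\<^sup>L (lborel \<Otimes>\<^sub>M lborel) ?h =
        (LINT z|lborel. LINT w|lborel. \<phi> z / (z - p) * (\<psi> w / (w - p)))"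
      using lborel_pair.integral_fst[OF h] by simp
    then show ?thesis
      by (simp only: integral_mult_right_zero integral_mult_left_zero cauchy_transform_def)
  qed
  moreover have "integral\<^sup>L (lborel \<Otimes>\<^sub>M lborel) (\<lambda>x. ?f x + ?g' x) =
      integral\<^sup>L (lborel \<Otimes>\<^sub>M lborel) ?f + integral\<^sup>L (lborel \<Otimes>\<^sub>M lborel) ?g"
    unfolding int_g'[symmetric] using f g' by (rule Bochner_Integration.integral_add)
  ultimately show ?thesis
    using eq integral_iterated_cauchy_kernel[OF assms] integral_iterated_cauchy_kernel[OF assms(2,1)]
    by simp
qed

section \<open>The Cauchy-Pompeiu formula\<close>

lemma nn_integral_FTC_UNIV:
  fixes f F :: "real \<Rightarrow> real"
  assumes F: "\<And>x. (F has_real_derivative f x) (at x)" and f: "\<And>x. isCont f x" "\<And>x. 0 \<le> f x"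
    and lim: "(F \<longlongrightarrow> A) at_bot" "(F \<longlongrightarrow> B) at_top"
  shows "(\<integral>\<^sup>+x. ennreal (f x) \<partial>lborel) = ennreal (B - A)"
proof -
  note FTC = interval_integral_FTC_nonneg[of "-\<infinity>" "\<infinity>" F f A B]
  have "set_integrable lborel (einterval (-\<infinity>) \<infinity>) f"
    by (rule FTC) (use assms in \<open>simp_all add: ereal_tendsto_simps\<close>)
  then have "integrable lborel f" by (simp add: set_integrable_def)
  moreover have "(LBINT x=-\<infinity>..\<infinity>. f x) = B - A"
    by (rule FTC) (use assms in \<open>simp_all add: ereal_tendsto_simps\<close>)
  then have "(LINT x|lborel. f x) = B - A"
    by (simp add: interval_lebesgue_integral_def set_lebesgue_integral_def)
  ultimately show ?thesis using f(2) by (simp add: nn_integral_eq_integral)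
qed

text \<open>The substitution y = a tan t turns the integrand into (cos t)^2 / a^3, whose
  antiderivative is (t + sin t cos t) / (2 a^3); \<open>?F\<close> is this with t =
  arctan(y/a).\<close>

lemma nn_integral_inverse_square_quadratic:
  fixes a :: real assumes a: "0 < a"
  shows "(\<integral>\<^sup>+y. ennreal (1 / (a\<^sup>2 + y\<^sup>2)\<^sup>2) \<partial>lborel) = ennreal (pi / (2 * a ^ 3))"
proof -
  have pos: "0 < a\<^sup>2 + y\<^sup>2" for y using a by (simp add: add_pos_nonneg)
  let ?F = "\<lambda>y. (arctan (y / a) + sin (arctan (y / a)) * cos (arctan (y / a))) / (2 * a ^ 3)"
  have "(\<integral>\<^sup>+y. ennreal (1 / (a\<^sup>2 + y\<^sup>2)\<^sup>2) \<partial>lborel) =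
    ennreal ((pi / 2 + sin (pi / 2) * cos (pi / 2)) / (2 * a ^ 3) -
             (- (pi / 2) + sin (- (pi / 2)) * cos (- (pi / 2))) / (2 * a ^ 3))"
  proof (rule nn_integral_FTC_UNIV[where F="?F"])
    fix y
    have c2: "(cos (arctan (y / a)))\<^sup>2 = a\<^sup>2 / (a\<^sup>2 + y\<^sup>2)"
      using a pos[of y] by (simp add: cos_arctan power_divide field_simps add_nonneg_nonneg)
    have s2: "(sin (arctan (y / a)))\<^sup>2 = 1 - a\<^sup>2 / (a\<^sup>2 + y\<^sup>2)"
      using c2 by (simp add: sin_squared_eq)
    have d: "1 / a / (1 + (y / a)\<^sup>2) = a / (a\<^sup>2 + y\<^sup>2)"
      using a pos[of y] by (simp add: power_divide field_simps power2_eq_square)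
    have der: "((\<lambda>y. arctan (y / a)) has_real_derivative a / (a\<^sup>2 + y\<^sup>2)) (at y)"
      unfolding d[symmetric] using a by (auto intro!: derivative_eq_intros simp: field_simps)
    have "(?F has_real_derivative (a / (a\<^sup>2 + y\<^sup>2) +
       (sin (arctan (y / a)) * (- sin (arctan (y / a)) * (a / (a\<^sup>2 + y\<^sup>2))) +
        cos (arctan (y / a)) * (a / (a\<^sup>2 + y\<^sup>2)) * cos (arctan (y / a)))) / (2 * a ^ 3)) (at y)"
      by (intro DERIV_cdivide DERIV_add DERIV_mult' DERIV_chain2[OF DERIV_sin] DERIV_chain2[OF DERIV_cos] der)
    also have "(a / (a\<^sup>2 + y\<^sup>2) +
       (sin (arctan (y / a)) * (- sin (arctan (y / a)) * (a / (a\<^sup>2 + y\<^sup>2))) +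
        cos (arctan (y / a)) * (a / (a\<^sup>2 + y\<^sup>2)) * cos (arctan (y / a)))) / (2 * a ^ 3) =
      a / (a\<^sup>2 + y\<^sup>2) * (1 - (sin (arctan (y / a)))\<^sup>2 + (cos (arctan (y / a)))\<^sup>2) / (2 * a ^ 3)"
      by (simp add: power2_eq_square algebra_simps)
    also have "\<dots> = 1 / (a\<^sup>2 + y\<^sup>2)\<^sup>2"
      unfolding c2 s2 using a pos[of y] by (simp add: power2_eq_square power3_eq_cube)
    finally show "(?F has_real_derivative 1 / (a\<^sup>2 + y\<^sup>2)\<^sup>2) (at y)" .
    show "isCont (\<lambda>y. 1 / (a\<^sup>2 + y\<^sup>2)\<^sup>2) y"
      using pos[of y] by (intro continuous_intros) auto
  next
    have bot: "((\<lambda>y. arctan (y / a)) \<longlongrightarrow> - (pi / 2)) at_bot"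
      by (rule filterlim_compose[OF tendsto_arctan_at_bot])
         (use filterlim_tendsto_pos_mult_at_bot[OF tendsto_const, of "1 / a" "\<lambda>y. y" at_bot] a
          in \<open>simp add: filterlim_ident\<close>)
    have top: "((\<lambda>y. arctan (y / a)) \<longlongrightarrow> pi / 2) at_top"
      by (rule filterlim_compose[OF tendsto_arctan_at_top])
         (use filterlim_tendsto_pos_mult_at_top[OF tendsto_const, of "1 / a" "\<lambda>y. y" at_top] a
          in \<open>simp add: filterlim_ident\<close>)
    show "(?F \<longlongrightarrow> (- (pi / 2) + sin (- (pi / 2)) * cos (- (pi / 2))) / (2 * a ^ 3)) at_bot"
      using a by (intro tendsto_intros bot) auto
    show "(?F \<longlongrightarrow> (pi / 2 + sin (pi / 2) * cos (pi / 2)) / (2 * a ^ 3)) at_top"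
      using a by (intro tendsto_intros top) auto
  qed (auto)
  then show ?thesis using a by (simp add: field_simps)
qed

text \<open>With x = tan t the integrand becomes cos t, so the antiderivative is sin(arctan x),
  which runs from -1 to 1.\<close>

lemma nn_integral_inverse_sqrt_cube:
  "(\<integral>\<^sup>+x. ennreal (1 / sqrt (1 + x\<^sup>2) ^ 3) \<partial>lborel) = 2"
proof -
  have pos: "0 < 1 + x\<^sup>2" for x :: real by (simp add: add_pos_nonneg)
  have "(\<integral>\<^sup>+x. ennreal (1 / sqrt (1 + x\<^sup>2) ^ 3) \<partial>lborel) = ennreal (sin (pi / 2) - sin (- (pi / 2)))"
  proof (rule nn_integral_FTC_UNIV)
    fix x :: real
    have "((\<lambda>x. sin (arctan x)) has_real_derivative cos (arctan x) * inverse (1 + x\<^sup>2)) (at x)"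
      by (auto intro!: derivative_eq_intros)
    also have "cos (arctan x) * inverse (1 + x\<^sup>2) = 1 / (sqrt (1 + x\<^sup>2) * (sqrt (1 + x\<^sup>2))\<^sup>2)"
      using pos[of x] by (simp add: cos_arctan field_simps)
    also have "\<dots> = 1 / sqrt (1 + x\<^sup>2) ^ 3"
      by (simp only: power3_eq_cube power2_eq_square mult.assoc)
    finally show "((\<lambda>x. sin (arctan x)) has_real_derivative 1 / sqrt (1 + x\<^sup>2) ^ 3) (at x)" .
    show "isCont (\<lambda>x. 1 / sqrt (1 + x\<^sup>2) ^ 3) x"
      using pos[of x] by (intro continuous_intros) auto
    show "((\<lambda>x. sin (arctan x)) \<longlongrightarrow> sin (- (pi / 2))) at_bot"
      by (rule tendsto_sin[OF tendsto_arctan_at_bot])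
    show "((\<lambda>x. sin (arctan x)) \<longlongrightarrow> sin (pi / 2)) at_top"
      by (rule tendsto_sin[OF tendsto_arctan_at_top])
  qed auto
  then show ?thesis by simp
qed

text \<open>The origin of the constant in the Cauchy-Pompeiu formula. For fixed x the inner integral
  is the quadratic one with a = sqrt(1 + x^2), which leaves the inverse cube for the outer
  integral.\<close>

lemma nn_integral_lorentzian:
  "(\<integral>\<^sup>+z. ennreal (1 / ((cmod z)\<^sup>2 + 1)\<^sup>2) \<partial>lborel) = ennreal pi"
proof -
  have "(\<integral>\<^sup>+z. ennreal (1 / ((cmod z)\<^sup>2 + 1)\<^sup>2) \<partial>lborel) =
      (\<integral>\<^sup>+x. \<integral>\<^sup>+y. ennreal (1 / ((sqrt (1 + x\<^sup>2))\<^sup>2 + y\<^sup>2)\<^sup>2) \<partial>lborel \<partial>lborel)"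
    by (subst nn_integral_lborel_complex) (auto simp: cmod_power2 add_ac)
  also have "\<dots> = (\<integral>\<^sup>+x. ennreal (pi / 2) * ennreal (1 / sqrt (1 + x\<^sup>2) ^ 3) \<partial>lborel)"
  proof (rule nn_integral_cong)
    fix x :: real
    have "0 < sqrt (1 + x\<^sup>2)" by (simp add: add_pos_nonneg)
    then show "(\<integral>\<^sup>+y. ennreal (1 / ((sqrt (1 + x\<^sup>2))\<^sup>2 + y\<^sup>2)\<^sup>2) \<partial>lborel) =
        ennreal (pi / 2) * ennreal (1 / sqrt (1 + x\<^sup>2) ^ 3)"
      by (subst nn_integral_inverse_square_quadratic) (auto simp: ennreal_mult[symmetric])
  qed
  also have "\<dots> = ennreal (pi / 2) * 2"
    by (subst nn_integral_cmult) (auto simp: nn_integral_inverse_sqrt_cube)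
  also have "\<dots> = ennreal pi"
    by (metis ennreal_mult ennreal_numeral field_sum_of_halves mult_2_right pi_half_ge_zero zero_le_numeral)
  finally show ?thesis .
qed

text \<open>Integration by parts without boundary terms: by translation invariance every difference
  quotient of \<open>F\<close> has integral 0, and dominated convergence passes to the
  derivative.\<close>

lemma integral_directional_derivative:
  fixes F :: "'a::euclidean_space \<Rightarrow> 'b::euclidean_space"
  assumes der: "\<And>x. (F has_derivative F' x) (at x)"
    and cont: "continuous_on UNIV (\<lambda>x. F' x v)"
    and supp: "bounded {x. F x \<noteq> 0}"
  shows "integrable lborel (\<lambda>x. F' x v)" "(LINT x|lborel. F' x v) = 0"
proof -
  obtain r where r: "\<And>x. F x \<noteq> 0 \<Longrightarrow> norm x \<le> r"
    using supp unfolding bounded_iff by auto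
  have zero: "F' x v = 0" if "x \<notin> cball 0 r" for x
  proof -
    have "((\<lambda>x. 0) has_derivative F' x) (at x)"
      by (rule has_derivative_transform_within_open[OF der, of "- cball 0 r"])
         (use that r in \<open>auto simp: open_Compl\<close>)
    then have "F' x = (\<lambda>h. 0)" by (rule has_derivative_unique) simp
    then show ?thesis by simp
  qed
  have "bounded ((\<lambda>x. F' x v) ` cball 0 r)"
    by (intro compact_imp_bounded compact_continuous_image continuous_on_subset[OF cont]) auto
  then obtain M where M0: "0 < M" and "\<And>x. x \<in> cball 0 r \<Longrightarrow> norm (F' x v) \<le> M"
    unfolding bounded_pos by auto
  with zero have M: "norm (F' x v) \<le> M" for x
    by (cases "x \<in> cball 0 r") auto
  have [measurable]: "F \<in> borel_measurable borel"
    using der by (intro borel_measurable_continuous_onI continuous_at_imp_continuous_on)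
                 (auto intro: has_derivative_continuous)
  have [measurable]: "(\<lambda>x. F' x v) \<in> borel_measurable borel"
    using cont by (rule borel_measurable_continuous_onI)
  \<comment> \<open>The difference quotient in direction \<open>v\<close> with step 1/(n +
    1).\<close>
  define s where "s n x = real (Suc n) *\<^sub>R (F (inverse (real (Suc n)) *\<^sub>R v + x) - F x)" for n x
  have [measurable]: "s n \<in> borel_measurable borel" for n unfolding s_def by measurable
  have F_int: "integrable lborel F"
  proof -
    have "continuous_on UNIV F"
      using der by (auto intro!: continuous_at_imp_continuous_on intro: has_derivative_continuous)
    then have "set_integrable lborel (cball 0 r) F"
      unfolding set_integrable_def by (intro borel_integrable_compact) (auto intro: continuous_on_subset)
    then show ?thesis unfolding set_integrable_def
      by (rule Bochner_Integration.integrable_cong[THEN iffD1, rotated -1])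
         (use r in \<open>auto simp: indicator_def\<close>)
  qed
  have shift: "integrable lborel (\<lambda>x. F (c + x))" "(LINT x|lborel. F (c + x)) = integral\<^sup>L lborel F" for c
    using F_int lborel_distr_plus[of c] integrable_distr_eq[of "(+) c" lborel borel F]
      integral_distr[of "(+) c" lborel borel F] by auto
  have s0: "integral\<^sup>L lborel (s n) = 0" for n
    unfolding s_def using F_int shift by simp
  \<comment> \<open>The mean value inequality gives the bound \<open>M\<close>. The radius grows by
    \<open>norm v\<close> because a step moves the support by at most that much.\<close>
  have s_bound: "norm (s n x) \<le> M * indicator (cball 0 (r + norm v)) x" for n x
  proof (cases "x \<in> cball 0 (r + norm v)")
    case True
    let ?h = "inverse (real (Suc n))"
    have h: "0 < ?h" by simp
    have der': "((\<lambda>t. F (t *\<^sub>R v + x)) has_derivative (\<lambda>h. F' (t *\<^sub>R v + x) (h *\<^sub>R v))) (at t)" for t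
      by (rule has_derivative_compose[of "\<lambda>t. t *\<^sub>R v + x", OF _ der])
         (auto intro!: derivative_eq_intros)
    obtain t where "norm (F (?h *\<^sub>R v + x) - F (0 *\<^sub>R v + x)) \<le> norm (F' (t *\<^sub>R v + x) ((?h - 0) *\<^sub>R v))"
      using mvt_general[OF h, of "\<lambda>t. F (t *\<^sub>R v + x)", OF _ der'] der'
      by (auto intro!: continuous_at_imp_continuous_on intro: has_derivative_continuous)
    also have "\<dots> = ?h * norm (F' (t *\<^sub>R v + x) v)"
      using has_derivative_bounded_linear[OF der] by (simp add: linear_simps)
    also have "\<dots> \<le> ?h * M" by (intro mult_left_mono M) auto
    finally have "norm (F (?h *\<^sub>R v + x) - F x) \<le> ?h * M" by simp
    then have "real (Suc n) * norm (F (?h *\<^sub>R v + x) - F x) \<le> real (Suc n) * (?h * M)"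
      by (intro mult_left_mono) auto
    moreover have "real (Suc n) * (?h * M) = M"
      by (simp add: mult.assoc[symmetric] del: of_nat_Suc)
    moreover have "norm (s n x) = real (Suc n) * norm (F (?h *\<^sub>R v + x) - F x)"
      by (simp only: s_def norm_scaleR abs_of_nat)
    ultimately have "norm (s n x) \<le> M" by (simp only:)
    then show ?thesis using True by simp
  next
    case False
    then have x: "r + norm v < norm x" by simp
    have "norm (inverse (real (Suc n)) *\<^sub>R v) \<le> norm v"
      by (simp add: field_simps)
    with x norm_triangle_ineq2[of x "- (inverse (real (Suc n)) *\<^sub>R v)"]
    have "r < norm (inverse (real (Suc n)) *\<^sub>R v + x)" by (simp add: add.commute)
    moreover have "r < norm x" using x norm_ge_zero[of v] by linarith
    ultimately have "F (inverse (real (Suc n)) *\<^sub>R v + x) = 0" "F x = 0"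
      using r by (meson not_le)+
    then show ?thesis using M0 by (simp add: s_def)
  qed
  have s_lim: "(\<lambda>n. s n x) \<longlonglongrightarrow> F' x v" for x
  proof (cases "v = 0")
    case True
    then show ?thesis using has_derivative_bounded_linear[OF der] by (simp add: s_def linear_simps)
  next
    case False
    have "((\<lambda>h. norm (F (x + h) - F x - F' x h) / norm h) \<longlongrightarrow> 0) (at 0)"
      using der by (simp add: has_derivative_at)
    moreover have "filterlim (\<lambda>n. inverse (real (Suc n)) *\<^sub>R v) (at 0) sequentially"
      unfolding filterlim_at using False tendsto_scaleR[OF LIMSEQ_inverse_real_of_nat tendsto_const[of v]]
      by (auto simp del: of_nat_Suc)
    ultimately have "(\<lambda>n. norm (F (x + inverse (real (Suc n)) *\<^sub>R v) - F x - F' x (inverse (real (Suc n)) *\<^sub>R v))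
        / norm (inverse (real (Suc n)) *\<^sub>R v)) \<longlonglongrightarrow> 0"
      by (rule filterlim_compose)
    \<comment> \<open>The quotient in the definition of the Frechet derivative divides by the length
      of the step times \<open>v\<close>; the factor \<open>norm v\<close> turns it into the error
      of the difference quotient.\<close>
    then have "(\<lambda>n. norm v * (norm (F (x + inverse (real (Suc n)) *\<^sub>R v) - F x - F' x (inverse (real (Suc n)) *\<^sub>R v))
        / norm (inverse (real (Suc n)) *\<^sub>R v))) \<longlonglongrightarrow> norm v * 0"
      by (intro tendsto_intros)
    have scale: "norm v * (norm X / (\<bar>inverse N\<bar> * norm v)) = N * norm X" if "0 < N" for X :: 'b and N
      using that False by (simp add: field_simps)
    note \<open>_ \<longlonglongrightarrow> norm v * 0\<close>
    also have "(\<lambda>n. norm v * (norm (F (x + inverse (real (Suc n)) *\<^sub>R v) - F x - F' x (inverse (real (Suc n)) *\<^sub>R v))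
        / norm (inverse (real (Suc n)) *\<^sub>R v))) = (\<lambda>n. norm (s n x - F' x v))"
    proof
      fix n
      have "s n x - F' x v = real (Suc n) *\<^sub>R
          (F (x + inverse (real (Suc n)) *\<^sub>R v) - F x - F' x (inverse (real (Suc n)) *\<^sub>R v))"
        using has_derivative_bounded_linear[OF der]
        by (simp add: s_def linear_simps scaleR_diff_right add.commute del: of_nat_Suc)
      then show "norm v * (norm (F (x + inverse (real (Suc n)) *\<^sub>R v) - F x - F' x (inverse (real (Suc n)) *\<^sub>R v))
        / norm (inverse (real (Suc n)) *\<^sub>R v)) = norm (s n x - F' x v)"
        using scale[of "real (Suc n)"] by (simp only: norm_scaleR abs_of_nat of_nat_0_less_iff zero_less_Suc)
    qed
    finally have "(\<lambda>n. norm (s n x - F' x v)) \<longlonglongrightarrow> 0" by (simp only: mult_zero_right)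
    then show ?thesis by (rule LIM_zero_cancel[OF tendsto_norm_zero_cancel])
  qed
  have dom: "integrable lborel (\<lambda>x. M * indicator (cball (0::'a) (r + norm v)) x)"
    by (intro integrable_mult_right integrable_real_indicator) (auto simp: emeasure_lborel_cball_finite[unfolded infinity_ennreal_def])
  have "(\<lambda>n. integral\<^sup>L lborel (s n)) \<longlonglongrightarrow> (LINT x|lborel. F' x v)"
    by (rule integral_dominated_convergence[OF _ _ dom]) (use s_lim s_bound in auto)
  then show "(LINT x|lborel. F' x v) = 0"
    unfolding s0 using LIMSEQ_unique tendsto_const by metis
  show "integrable lborel (\<lambda>x. F' x v)"
  proof (rule Bochner_Integration.integrable_bound[OF dom])
    have "norm (F' x v) \<le> M * indicator (cball 0 (r + norm v)) x" for x
      by (rule tendsto_upperbound[OF tendsto_norm[OF s_lim]]) (use s_bound in auto)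
    then show "AE x in lborel. norm (F' x v) \<le> norm (M * indicator (cball 0 (r + norm v)) x)"
      using M0 by simp
  qed simp
qed

lemma integral_lborel_affine:
  fixes g :: "'a::euclidean_space \<Rightarrow> 'b::{banach, second_countable_topology}"
  assumes [measurable]: "g \<in> borel_measurable borel" and c: "c \<noteq> 0"
  shows "integral\<^sup>L lborel g = (LINT x|lborel. \<bar>c\<bar> ^ DIM('a) *\<^sub>R g (t + c *\<^sub>R x))"
  by (subst lborel_affine[OF c, of t], subst integral_density, simp, simp, simp)
     (subst integral_distr, simp_all)

section \<open>Test functions and their derivatives as bounded functions of bounded support\<close>

lemma test_function_has_derivative:
  assumes "\<phi> \<in> test_functions"
  shows "(\<phi> has_derivative frechet_derivative \<phi> (at z)) (at z)"
proof -
  have "iter_deriv [] \<phi> differentiable (at z)"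
    using assms unfolding test_functions_def smooth_on_def by blast
  then show ?thesis by (simp add: frechet_derivative_works)
qed

lemma continuous_on_test_function:
  "\<phi> \<in> test_functions \<Longrightarrow> continuous_on S \<phi>"
  by (blast intro: continuous_at_imp_continuous_on has_derivative_continuous test_function_has_derivative)

lemma continuous_on_test_function_partial:
  assumes "\<phi> \<in> test_functions" "v \<in> Basis"
  shows "continuous_on S (\<lambda>z. frechet_derivative \<phi> (at z) v)"
proof -
  have "\<forall>vs\<in>lists Basis. \<forall>z\<in>UNIV. iter_deriv vs \<phi> differentiable (at z)"
    using assms(1) by (simp add: test_functions_def smooth_on_def)
  moreover have "[v] \<in> lists Basis" using assms(2) by simp
  ultimately have "iter_deriv [v] \<phi> differentiable (at z)" for z by blast
  then have "isCont (\<lambda>z. frechet_derivative \<phi> (at z) v) z" for z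
    using differentiable_imp_continuous_within by fastforce
  then show ?thesis by (blast intro: continuous_at_imp_continuous_on)
qed

lemma bounded_support_test_function:
  assumes "\<phi> \<in> test_functions"
  shows "bounded {z. \<phi> z \<noteq> 0}"
  using assms closure_subset
  by (auto simp: test_functions_def fsupport_def intro: bounded_subset[OF compact_imp_bounded])

lemma cs_bounded_continuous:
  assumes "continuous_on UNIV f" "bounded {z. f z \<noteq> 0}"
  shows "cs_bounded f"
proof -
  obtain r where r: "{z. f z \<noteq> 0} \<subseteq> cball 0 r"
    using assms(2) by (auto simp: bounded_iff subset_iff)
  have "bounded (f ` cball 0 r)"
    by (intro compact_imp_bounded compact_continuous_image continuous_on_subset[OF assms(1)]) auto
  moreover have "range f \<subseteq> insert 0 (f ` cball 0 r)" using r by auto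
  ultimately have "bounded (range f)" by (meson bounded_insert bounded_subset)
  then show ?thesis
    using assms by (simp add: cs_bounded_def borel_measurable_continuous_onI)
qed

lemma cs_bounded_test_function: "\<phi> \<in> test_functions \<Longrightarrow> cs_bounded \<phi>"
  by (intro cs_bounded_continuous continuous_on_test_function bounded_support_test_function)

text \<open>The spectral distribution evaluates \<open>R\<close> at \<open>dbar \<phi>\<close>; this
  places it in the class covered by \<open>resolvent_distribution_eq\<close>. Outside the closed
  support \<open>\<phi>\<close> vanishes near the point, so its derivative is zero.\<close>

lemma cs_bounded_dbar:
  assumes "\<phi> \<in> test_functions"
  shows "cs_bounded (dbar \<phi>)"
proof (rule cs_bounded_continuous)
  show "continuous_on UNIV (dbar \<phi>)"
    unfolding dbar_def[abs_def] using assms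
    by (intro continuous_intros continuous_on_test_function_partial) (auto simp: Basis_complex_def)
  have "dbar \<phi> z = 0" if "z \<notin> fsupport \<phi>" for z
  proof -
    have "((\<lambda>z. 0) has_derivative frechet_derivative \<phi> (at z)) (at z)"
      by (rule has_derivative_transform_within_open[OF test_function_has_derivative[OF assms], of "- fsupport \<phi>"])
         (use that closure_subset[of "{z. \<phi> z \<noteq> 0}"] in \<open>auto simp: fsupport_def\<close>)
    then have "frechet_derivative \<phi> (at z) = (\<lambda>h. 0)" by (rule has_derivative_unique) simp
    then show ?thesis by (simp add: dbar_def)
  qed
  then show "bounded {z. dbar \<phi> z \<noteq> 0}"
    using assms by (auto simp: test_functions_def intro: bounded_subset[OF compact_imp_bounded])
qed

lemma cs_bounded_integrable:
  assumes "cs_bounded f" shows "integrable lborel f"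
proof -
  obtain B r where B: "\<And>z. cmod (f z) \<le> B" and r: "\<And>z. f z \<noteq> 0 \<Longrightarrow> cmod z \<le> r"
    using assms unfolding cs_bounded_def bounded_iff by auto
  have "integrable lborel (\<lambda>z. B * indicator (cball (0::complex) r) z)"
    by (intro integrable_mult_right integrable_real_indicator) (auto simp: emeasure_lborel_cball_finite[unfolded infinity_ennreal_def])
  then show ?thesis
  proof (rule Bochner_Integration.integrable_bound)
    show "f \<in> borel_measurable lborel" using assms by (simp add: cs_bounded_def)
    have "norm (f z) \<le> norm (B * indicator (cball (0::complex) r) z)" for z
      using B[of z] r[of z] by (cases "f z = 0") (auto simp: indicator_def)
    then show "AE z in lborel. norm (f z) \<le> norm (B * indicator (cball (0::complex) r) z)" by simp
  qed
qed

text \<open>The smooth approximation \<open>cnj w/(\<bar>w\<bar>\<^sup>2 + s\<^sup>2)\<close> of \<open>1/w\<close> has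
  \<open>dbar\<close>-derivative \<open>s\<^sup>2/(\<bar>w\<bar>\<^sup>2 + s\<^sup>2)\<^sup>2\<close>.\<close>

lemma integral_dbar_regularized_kernel:
  fixes s :: real and p :: complex
  assumes \<phi>: "\<phi> \<in> test_functions" and s: "0 < s"
  shows "(LINT z|lborel. dbar \<phi> z * (cnj (z - p) / of_real ((cmod (z - p))\<^sup>2 + s\<^sup>2))) =
    - (LINT z|lborel. \<phi> z * of_real (s\<^sup>2 / ((cmod (z - p))\<^sup>2 + s\<^sup>2)\<^sup>2))"
proof -
  \<comment> \<open>The denominator written as a polynomial in \<open>z\<close> and its conjugate,
    so that the differentiation rules apply.\<close>
  define Q where "Q z = (z - p) * cnj (z - p) + of_real (s\<^sup>2)" for z
  have Q: "Q z = of_real ((cmod (z - p))\<^sup>2 + s\<^sup>2)" for z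
    by (simp only: Q_def of_real_add complex_norm_square)
  have Q0: "Q z \<noteq> 0" for z
    unfolding Q of_real_eq_0_iff using s by (simp add: add_nonneg_pos pos_add_strict less_imp_neq[symmetric])
  define k where "k z = cnj (z - p) / Q z" for z
  \<comment> \<open>The quotient rule after cancellation of the terms
    \<open>cnj h * (z - p) * cnj (z - p)\<close>. The coefficient of \<open>cnj h\<close> is the
    dbar-derivative, that of \<open>h\<close> the holomorphic one.\<close>
  define k' where "k' z h = (cnj h * of_real (s\<^sup>2) - (cnj (z - p))\<^sup>2 * h) / (Q z)\<^sup>2" for z h
  have k: "(k has_derivative k' z) (at z)" for z
  proof -
    have "((\<lambda>z. cnj (z - p) / Q z) has_derivative
        (\<lambda>h. (cnj h * Q z - cnj (z - p) * (h * cnj (z - p) + (z - p) * cnj h)) / (Q z * Q z))) (at z)"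
      unfolding Q_def using Q0[of z, unfolded Q_def]
      by (auto intro!: derivative_eq_intros has_derivative_divide' has_derivative_cnj simp: algebra_simps)
    also have "(\<lambda>h. (cnj h * Q z - cnj (z - p) * (h * cnj (z - p) + (z - p) * cnj h)) / (Q z * Q z)) = k' z"
      unfolding k'_def power2_eq_square by (rule ext, rule arg_cong[where f="\<lambda>u. u / (Q z * Q z)"])
        (simp add: Q_def algebra_simps power2_eq_square)
    finally show ?thesis unfolding k_def[abs_def] .
  qed
  let ?D = "\<lambda>z. frechet_derivative \<phi> (at z)"
  define F' where "F' z h = \<phi> z * k' z h + ?D z h * k z" for z h
  have F: "((\<lambda>z. \<phi> z * k z) has_derivative F' z) (at z)" for z
    unfolding F'_def[abs_def] by (intro has_derivative_mult test_function_has_derivative \<phi> k)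
  have contQ: "continuous_on UNIV Q" unfolding Q_def[abs_def] by (intro continuous_intros)
  have contk: "continuous_on UNIV k"
    unfolding k_def[abs_def] using Q0 by (intro continuous_intros contQ) auto
  have contk': "continuous_on UNIV (\<lambda>z. k' z h)" for h
    unfolding k'_def[abs_def] using Q0 by (intro continuous_intros contQ) auto
  have contF: "continuous_on UNIV (\<lambda>z. F' z v)" if "v \<in> Basis" for v
    unfolding F'_def[abs_def]
    by (intro continuous_intros contk contk' continuous_on_test_function continuous_on_test_function_partial \<phi> that)
  have suppF: "bounded {z. \<phi> z * k z \<noteq> 0}"
    by (rule bounded_subset[OF bounded_support_test_function[OF \<phi>]]) auto
  have one: "integrable lborel (\<lambda>z. F' z 1)" "(LINT z|lborel. F' z 1) = 0"
    and im: "integrable lborel (\<lambda>z. F' z \<i>)" "(LINT z|lborel. F' z \<i>) = 0"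
    by (rule integral_directional_derivative[OF F contF suppF], simp add: Basis_complex_def)+
  \<comment> \<open>The left side is dbar of the product of \<open>\<phi>\<close> and
    \<open>k\<close>; its integral vanishes because both directional derivatives integrate to
    0.\<close>
  have sum: "(F' z 1 + \<i> * F' z \<i>) / 2 = \<phi> z * of_real (s\<^sup>2 / ((cmod (z - p))\<^sup>2 + s\<^sup>2)\<^sup>2) + dbar \<phi> z * k z" for z
  proof -
    have "(k' z 1 + \<i> * k' z \<i>) / 2 = of_real (s\<^sup>2) / (Q z)\<^sup>2"
    proof -
      \<comment> \<open>Since \<open>cnj \<i> = -\<i>\<close>, the antilinear part of
        \<open>k'\<close> is reproduced and the linear part changes sign; adding the direction 1
        leaves only the antilinear part.\<close>
      have "\<i> * (cnj \<i> * a - c * \<i>) = a + c" for a c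
        by (simp add: algebra_simps)
      then have "\<i> * k' z \<i> = (of_real (s\<^sup>2) + (cnj (z - p))\<^sup>2) / (Q z)\<^sup>2"
        by (simp only: k'_def times_divide_eq_right)
      moreover have "k' z 1 = (of_real (s\<^sup>2) - (cnj (z - p))\<^sup>2) / (Q z)\<^sup>2"
        by (simp only: k'_def complex_cnj_one mult_1_left mult_1_right)
      moreover have "((a - c) / q + (a + c) / q) / 2 = a / q" for a c q :: complex
        by (simp flip: add_divide_distrib)
      ultimately show ?thesis by (simp only:)
    qed
    moreover have "(F' z 1 + \<i> * F' z \<i>) / 2 = \<phi> z * ((k' z 1 + \<i> * k' z \<i>) / 2) + dbar \<phi> z * k z"
      by (simp add: F'_def dbar_def algebra_simps add_divide_distrib)
    ultimately show ?thesis by (simp add: Q)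
  qed
  have "integrable lborel (\<lambda>z. (F' z 1 + \<i> * F' z \<i>) / 2)"
    using one im by simp
  moreover have "(LINT z|lborel. (F' z 1 + \<i> * F' z \<i>) / 2) = 0"
    using one im by simp
  ultimately have A: "integrable lborel (\<lambda>z. \<phi> z * of_real (s\<^sup>2 / ((cmod (z - p))\<^sup>2 + s\<^sup>2)\<^sup>2) + dbar \<phi> z * k z)"
    "(LINT z|lborel. \<phi> z * of_real (s\<^sup>2 / ((cmod (z - p))\<^sup>2 + s\<^sup>2)\<^sup>2) + dbar \<phi> z * k z) = 0"
    unfolding sum by auto
  \<comment> \<open>The sum is known to be integrable; integrability of this summand yields that of
    the other by subtraction.\<close>
  have int_dbar: "integrable lborel (\<lambda>z. dbar \<phi> z * k z)"
  proof (rule cs_bounded_integrable, rule cs_bounded_continuous)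
    show "continuous_on UNIV (\<lambda>z. dbar \<phi> z * k z)"
      unfolding dbar_def[abs_def] using \<phi>
      by (intro continuous_intros contk continuous_on_test_function_partial) (auto simp: Basis_complex_def)
    show "bounded {z. dbar \<phi> z * k z \<noteq> 0}"
      using cs_bounded_dbar[OF \<phi>] by (auto simp: cs_bounded_def intro: bounded_subset)
  qed
  have "integrable lborel (\<lambda>z. \<phi> z * of_real (s\<^sup>2 / ((cmod (z - p))\<^sup>2 + s\<^sup>2)\<^sup>2))"
    using Bochner_Integration.integrable_diff[OF A(1) int_dbar] by simp
  from Bochner_Integration.integral_add[OF this int_dbar]
  have "(LINT z|lborel. \<phi> z * of_real (s\<^sup>2 / ((cmod (z - p))\<^sup>2 + s\<^sup>2)\<^sup>2)) +
      (LINT z|lborel. dbar \<phi> z * k z) = 0"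
    using A(2) by (simp only:)
  then show ?thesis unfolding k_def Q by (simp add: add_eq_0_iff)
qed

text \<open>Let s tend to 0 in the regularized identity. The left side is dominated by |dbar \<phi>|
  / |z - p|. On the right, z = p + s w turns the kernel into a fixed profile of mass pi against
  \<open>\<phi>(p + s w)\<close>, which tends to \<open>\<phi> p\<close>.\<close>

lemma cauchy_pompeiu:
  assumes \<phi>: "\<phi> \<in> test_functions"
  shows "cauchy_transform (dbar \<phi>) p = - of_real pi * \<phi> p"
proof -
  define s where "s n = inverse (real (Suc n))" for n
  have s: "0 < s n" for n by (simp add: s_def)
  have s_lim: "s \<longlonglongrightarrow> 0" unfolding s_def by (rule LIMSEQ_inverse_real_of_nat)
  define f where "f n z = dbar \<phi> z * (cnj (z - p) / of_real ((cmod (z - p))\<^sup>2 + (s n)\<^sup>2))" for n z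
  define g where "g n w = \<phi> (p + s n *\<^sub>R w) * of_real (1 / ((cmod w)\<^sup>2 + 1)\<^sup>2)" for n w
  have [measurable]: "\<phi> \<in> borel_measurable borel" "dbar \<phi> \<in> borel_measurable borel"
    using cs_bounded_test_function[OF \<phi>] cs_bounded_dbar[OF \<phi>] by (simp_all add: cs_bounded_def)
  have cnj_meas[measurable]: "cnj \<in> borel_measurable borel"
    by (intro borel_measurable_continuous_onI continuous_intros)
  have fg: "integral\<^sup>L lborel (f n) = - integral\<^sup>L lborel (g n)" for n
  proof -
    have "(LINT z|lborel. \<phi> z * of_real ((s n)\<^sup>2 / ((cmod (z - p))\<^sup>2 + (s n)\<^sup>2)\<^sup>2)) =
      (LINT w|lborel. \<bar>s n\<bar> ^ DIM(complex) *\<^sub>R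
        (\<phi> (p + s n *\<^sub>R w) * of_real ((s n)\<^sup>2 / ((cmod (p + s n *\<^sub>R w - p))\<^sup>2 + (s n)\<^sup>2)\<^sup>2)))"
      by (rule integral_lborel_affine) (use s[of n] in auto)
    also have "\<dots> = integral\<^sup>L lborel (g n)"
    proof (rule Bochner_Integration.integral_cong[OF refl])
      fix w
      \<comment> \<open>The first factor is the Jacobian in real dimension 2; together with the
        numerator it cancels the fourth power of \<open>s n\<close> in the denominator.\<close>
      have "(s n)\<^sup>2 * ((s n)\<^sup>2 / ((cmod (p + s n *\<^sub>R w - p))\<^sup>2 + (s n)\<^sup>2)\<^sup>2) = 1 / ((cmod w)\<^sup>2 + 1)\<^sup>2"
      proof -
        have "(cmod (p + s n *\<^sub>R w - p))\<^sup>2 + (s n)\<^sup>2 = (s n)\<^sup>2 * ((cmod w)\<^sup>2 + 1)"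
          by (simp add: power_mult_distrib distrib_left)
        then show ?thesis using s[of n] by (simp add: power_mult_distrib power2_eq_square)
      qed
      then show "\<bar>s n\<bar> ^ DIM(complex) *\<^sub>R
        (\<phi> (p + s n *\<^sub>R w) * of_real ((s n)\<^sup>2 / ((cmod (p + s n *\<^sub>R w - p))\<^sup>2 + (s n)\<^sup>2)\<^sup>2)) = g n w"
        unfolding g_def by (simp only: power2_abs DIM_complex scaleR_conv_of_real mult.left_commute[of "of_real _" "\<phi> _"]
          flip: of_real_mult)
    qed
    finally show ?thesis
      using integral_dbar_regularized_kernel[OF \<phi> s[of n], of p] by (simp only: f_def[abs_def])
  qed
  have f_bound: "norm (f n z) \<le> cmod (dbar \<phi> z / (z - p))" for n z
  proof (cases "z = p")
    case False
    have "cmod (z - p) / ((cmod (z - p))\<^sup>2 + (s n)\<^sup>2) \<le> cmod (z - p) / (cmod (z - p))\<^sup>2"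
      using False by (intro divide_left_mono) (auto simp: add_pos_nonneg)
    also have "\<dots> = 1 / cmod (z - p)" by (simp add: power2_eq_square)
    finally have "cmod (dbar \<phi> z) * (cmod (z - p) / ((cmod (z - p))\<^sup>2 + (s n)\<^sup>2)) \<le> cmod (dbar \<phi> z) * (1 / cmod (z - p))"
      by (intro mult_left_mono) auto
    moreover have "cmod (of_real ((cmod (z - p))\<^sup>2 + (s n)\<^sup>2)) = (cmod (z - p))\<^sup>2 + (s n)\<^sup>2"
      unfolding norm_of_real by (intro abs_of_nonneg) auto
    ultimately show ?thesis by (simp only: f_def norm_mult norm_divide complex_mod_cnj) simp
  qed (simp add: f_def)
  \<comment> \<open>At \<open>z = p\<close> both sides are 0: the regularized kernel has numerator
    0, and \<open>x / 0 = 0\<close>.\<close>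
  have f_lim: "(\<lambda>n. f n z) \<longlonglongrightarrow> dbar \<phi> z / (z - p)" for z
  proof (cases "z = p")
    case False
    have "(\<lambda>n. f n z) \<longlonglongrightarrow> dbar \<phi> z * (cnj (z - p) / of_real ((cmod (z - p))\<^sup>2 + 0\<^sup>2))"
      unfolding f_def using False by (intro tendsto_intros s_lim) (auto simp del: of_real_add of_real_power)
    also have "dbar \<phi> z * (cnj (z - p) / of_real ((cmod (z - p))\<^sup>2 + 0\<^sup>2)) = dbar \<phi> z / (z - p)"
    proof -
      have "of_real ((cmod (z - p))\<^sup>2 + 0\<^sup>2) = (z - p) * cnj (z - p)"
        by (simp only: complex_norm_square zero_power2 add_0_right)
      then show ?thesis using False by simp
    qed
    finally show ?thesis .
  qed (simp add: f_def)
  have "(\<lambda>n. integral\<^sup>L lborel (f n)) \<longlonglongrightarrow> cauchy_transform (dbar \<phi>) p"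
    unfolding cauchy_transform_def
  proof (rule integral_dominated_convergence[where w="\<lambda>z. cmod (dbar \<phi> z / (z - p))"])
    show "integrable lborel (\<lambda>z. cmod (dbar \<phi> z / (z - p)))"
      by (intro integrable_norm cauchy_integrable cs_bounded_dbar \<phi>)
    show "f n \<in> borel_measurable lborel" for n unfolding f_def[abs_def] by measurable
  qed (use f_lim f_bound in auto)
  moreover have "(\<lambda>n. integral\<^sup>L lborel (g n)) \<longlonglongrightarrow> of_real pi * \<phi> p"
  proof -
    \<comment> \<open>The integrable majorant for the rescaled integrals, up to the supremum of
      \<open>\<phi>\<close>.\<close>
    have lor: "integrable lborel (\<lambda>w::complex. 1 / ((cmod w)\<^sup>2 + 1)\<^sup>2)"
      "(LINT w::complex|lborel. 1 / ((cmod w)\<^sup>2 + 1)\<^sup>2) = pi"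
      using integrableI_nn_integral_finite[of "\<lambda>w::complex. 1 / ((cmod w)\<^sup>2 + 1)\<^sup>2" lborel pi]
        integral_eq_nn_integral[of "\<lambda>w::complex. 1 / ((cmod w)\<^sup>2 + 1)\<^sup>2" lborel]
      by (simp_all add: nn_integral_lorentzian)
    obtain B where B: "\<And>z. cmod (\<phi> z) \<le> B"
      using cs_bounded_test_function[OF \<phi>] unfolding cs_bounded_def bounded_iff by auto
    have "(\<lambda>n. integral\<^sup>L lborel (g n)) \<longlonglongrightarrow> (LINT w|lborel. \<phi> p * of_real (1 / ((cmod w)\<^sup>2 + 1)\<^sup>2))"
    proof (rule integral_dominated_convergence[where w="\<lambda>w. B * (1 / ((cmod w)\<^sup>2 + 1)\<^sup>2)"])
      show "integrable lborel (\<lambda>w::complex. B * (1 / ((cmod w)\<^sup>2 + 1)\<^sup>2))"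
        using lor(1) by (rule integrable_mult_right)
      show "AE w in lborel. (\<lambda>n. g n w) \<longlonglongrightarrow> \<phi> p * of_real (1 / ((cmod w)\<^sup>2 + 1)\<^sup>2)"
      proof (rule AE_I2)
        fix w
        have "(\<lambda>n. p + s n *\<^sub>R w) \<longlonglongrightarrow> p + 0 *\<^sub>R w" by (intro tendsto_intros s_lim)
        then have "(\<lambda>n. p + s n *\<^sub>R w) \<longlonglongrightarrow> p" by simp
        moreover have "isCont \<phi> p"
          using test_function_has_derivative[OF \<phi>] by (rule has_derivative_continuous)
        ultimately have "(\<lambda>n. \<phi> (p + s n *\<^sub>R w)) \<longlonglongrightarrow> \<phi> p" by (rule isCont_tendsto_compose[rotated])
        then show "(\<lambda>n. g n w) \<longlonglongrightarrow> \<phi> p * of_real (1 / ((cmod w)\<^sup>2 + 1)\<^sup>2)"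
          unfolding g_def by (intro tendsto_intros)
      qed
      have "norm (g n w) \<le> B * (1 / ((cmod w)\<^sup>2 + 1)\<^sup>2)" for n w
        unfolding g_def norm_mult norm_of_real using B by (simp add: divide_right_mono)
      then show "AE w in lborel. norm (g n w) \<le> B * (1 / ((cmod w)\<^sup>2 + 1)\<^sup>2)" for n by simp
      show "g n \<in> borel_measurable lborel" for n unfolding g_def[abs_def] by measurable
    qed simp
    also have "(LINT w|lborel. \<phi> p * of_real (1 / ((cmod w)\<^sup>2 + 1)\<^sup>2)) = of_real pi * \<phi> p"
      by (simp only: integral_mult_right_zero integral_complex_of_real lor(2) mult.commute)
    finally show ?thesis .
  qed
  then have "(\<lambda>n. integral\<^sup>L lborel (f n)) \<longlonglongrightarrow> - (of_real pi * \<phi> p)"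
    unfolding fg by (rule tendsto_minus)
  ultimately show ?thesis by (simp add: LIMSEQ_unique)
qed

section \<open>Multiplication operators on \<open>L\<^sup>2(G)\<close>\<close>

lemma L2_simps [simp]:
  "vcarrier (L2 G) = L2_functions G // L2_rel G"
  "vadd (L2 G) u v = L2_class G (\<lambda>y. L2_rep u y + L2_rep v y)"
  "vscale (L2 G) c u = L2_class G (\<lambda>y. c * L2_rep u y)"
  "vnorm (L2 G) u = sqrt (LINT y|lebesgue_on G. (cmod (L2_rep u y))\<^sup>2)"
  "vinner (L2 G) u v = (LINT y|lebesgue_on G. L2_rep u y * cnj (L2_rep v y))"
  by (simp_all add: L2_def L2_inner_def)

section \<open>The quotient space and its chosen representatives\<close>

lemma equiv_L2_rel: "equiv (L2_functions G) (L2_rel G)"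
proof (rule equivI)
  show "refl_on (L2_functions G) (L2_rel G)" by (auto simp: refl_on_def L2_rel_def)
  show "sym (L2_rel G)" by (auto simp: sym_def L2_rel_def elim: AE_mp)
  show "trans (L2_rel G)" unfolding trans_def L2_rel_def by (auto elim: AE_mp)
  show "L2_rel G \<subseteq> L2_functions G \<times> L2_functions G" by (auto simp: L2_rel_def)
qed

lemma L2_class_in_carrier [simp]: "f \<in> L2_functions G \<Longrightarrow> L2_class G f \<in> L2_functions G // L2_rel G"
  by (simp add: L2_class_def quotientI)

lemma L2_class_eqI:
  assumes "f \<in> L2_functions G" "g \<in> L2_functions G" "AE y in lebesgue_on G. f y = g y"
  shows "L2_class G f = L2_class G g"
  unfolding L2_class_def using assms by (intro equiv_class_eq[OF equiv_L2_rel]) (auto simp: L2_rel_def)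

lemma L2_carrierE:
  assumes "u \<in> L2_functions G // L2_rel G"
  obtains f where "f \<in> L2_functions G" "u = L2_class G f"
  using assms by (auto simp: quotient_def L2_class_def)

text \<open>The operations on classes are defined through a chosen representative; this allows that
  choice to be replaced by any given function of the class.\<close>

lemma L2_rep_class:
  assumes "f \<in> L2_functions G"
  shows "L2_rep (L2_class G f) \<in> L2_functions G" "AE y in lebesgue_on G. L2_rep (L2_class G f) y = f y"
proof -
  have "f \<in> L2_class G f"
    using assms by (simp add: L2_class_def L2_rel_def)
  then have "L2_rep (L2_class G f) \<in> L2_class G f" unfolding L2_rep_def by (rule someI[of "\<lambda>g. g \<in> L2_class G f"])
  then have "(f, L2_rep (L2_class G f)) \<in> L2_rel G" by (simp add: L2_class_def)
  then show "L2_rep (L2_class G f) \<in> L2_functions G" "AE y in lebesgue_on G. L2_rep (L2_class G f) y = f y"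
    by (auto simp: L2_rel_def elim: AE_mp)
qed

lemma L2_functionsD:
  assumes "f \<in> L2_functions G"
  shows "f \<in> borel_measurable (lebesgue_on G)" "integrable (lebesgue_on G) (\<lambda>y. (cmod (f y))\<^sup>2)"
  using assms by (auto simp: L2_functions_def)

lemma L2_functions_add:
  assumes "f \<in> L2_functions G" "g \<in> L2_functions G"
  shows "(\<lambda>y. f y + g y) \<in> L2_functions G"
proof -
  note [measurable] = L2_functionsD(1)[OF assms(1)] L2_functionsD(1)[OF assms(2)]
  have "integrable (lebesgue_on G) (\<lambda>y. (cmod (f y + g y))\<^sup>2)"
  proof (rule Bochner_Integration.integrable_bound)
    show "integrable (lebesgue_on G) (\<lambda>y. 2 * (cmod (f y))\<^sup>2 + 2 * (cmod (g y))\<^sup>2)"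
      using assms by (auto simp: L2_functions_def)
    have "(cmod (a + b))\<^sup>2 \<le> 2 * (cmod a)\<^sup>2 + 2 * (cmod b)\<^sup>2" for a b
    proof -
      have "(cmod (a + b))\<^sup>2 \<le> (cmod a + cmod b)\<^sup>2"
        by (intro power_mono norm_triangle_ineq) auto
      also have "\<dots> \<le> 2 * (cmod a)\<^sup>2 + 2 * (cmod b)\<^sup>2"
        using zero_le_power2[of "cmod a - cmod b"] by (simp add: power2_sum power2_diff)
      finally show ?thesis .
    qed
    then show "AE y in lebesgue_on G. norm ((cmod (f y + g y))\<^sup>2) \<le> norm (2 * (cmod (f y))\<^sup>2 + 2 * (cmod (g y))\<^sup>2)"
      by simp
  qed measurable
  then show ?thesis by (simp add: L2_functions_def)
qed

text \<open>Bounded everywhere on \<open>G\<close> rather than essentially bounded: the symbols in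
  use come with pointwise bounds, which then serve directly as bounds for the operator norm.\<close>

definition multiplier :: "'a::euclidean_space set \<Rightarrow> ('a \<Rightarrow> complex) \<Rightarrow> bool" where
  "multiplier G m \<longleftrightarrow> m \<in> borel_measurable (lebesgue_on G) \<and> bounded (m ` G)"

lemma multiplier_const: "multiplier G (\<lambda>_. c)"
  by (auto simp: multiplier_def bounded_iff)

lemma multiplier_mult:
  assumes "multiplier G m" "multiplier G n" shows "multiplier G (\<lambda>y. m y * n y)"
proof -
  obtain a b where "\<And>y. y \<in> G \<Longrightarrow> cmod (m y) \<le> a" "\<And>y. y \<in> G \<Longrightarrow> cmod (n y) \<le> b"
    using assms by (auto simp: multiplier_def bounded_iff)
  then have "cmod (m y * n y) \<le> \<bar>a\<bar> * \<bar>b\<bar>" if "y \<in> G" for y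
    unfolding norm_mult using that by (intro mult_mono) (auto intro: order_trans[OF _ abs_ge_self])
  then show ?thesis using assms by (auto simp: multiplier_def bounded_iff)
qed

lemma multiplier_add:
  assumes "multiplier G m" "multiplier G n" shows "multiplier G (\<lambda>y. m y + n y)"
proof -
  obtain a b where "\<And>y. y \<in> G \<Longrightarrow> cmod (m y) \<le> a" "\<And>y. y \<in> G \<Longrightarrow> cmod (n y) \<le> b"
    using assms by (auto simp: multiplier_def bounded_iff)
  then have "cmod (m y + n y) \<le> a + b" if "y \<in> G" for y
    using that by (intro norm_triangle_mono) auto
  then show ?thesis using assms by (auto simp: multiplier_def bounded_iff)
qed

lemma multiplier_diff:
  assumes "multiplier G m" "multiplier G n" shows "multiplier G (\<lambda>y. m y - n y)"
  using multiplier_add[OF assms(1) multiplier_mult[OF multiplier_const[of G "-1"] assms(2)]] by simp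

text \<open>The bound \<open>B\<close> stays explicit because it becomes the estimate of the
  operator norm.\<close>

lemma
  assumes m: "m \<in> borel_measurable (lebesgue_on G)" "\<And>y. y \<in> G \<Longrightarrow> cmod (m y) \<le> B"
    and f: "f \<in> L2_functions G"
  shows L2_functions_bounded_mult: "(\<lambda>y. m y * f y) \<in> L2_functions G"
    and integral_bounded_mult_le:
      "(LINT y|lebesgue_on G. (cmod (m y * f y))\<^sup>2) \<le> B\<^sup>2 * (LINT y|lebesgue_on G. (cmod (f y))\<^sup>2)"
proof -
  note [measurable] = m(1) L2_functionsD(1)[OF f]
  have le: "(cmod (m y * f y))\<^sup>2 \<le> B\<^sup>2 * (cmod (f y))\<^sup>2" if "y \<in> space (lebesgue_on G)" for y
    unfolding norm_mult power_mult_distrib using m(2)[of y] that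
    by (intro mult_right_mono power_mono) (auto simp: space_restrict_space)
  have int: "integrable (lebesgue_on G) (\<lambda>y. B\<^sup>2 * (cmod (f y))\<^sup>2)"
    using L2_functionsD(2)[OF f] by simp
  have int': "integrable (lebesgue_on G) (\<lambda>y. (cmod (m y * f y))\<^sup>2)"
    by (rule Bochner_Integration.integrable_bound[OF int]) (use le in \<open>auto simp del: norm_mult\<close>)
  then show "(\<lambda>y. m y * f y) \<in> L2_functions G" by (simp add: L2_functions_def)
  show "(LINT y|lebesgue_on G. (cmod (m y * f y))\<^sup>2) \<le> B\<^sup>2 * (LINT y|lebesgue_on G. (cmod (f y))\<^sup>2)"
    using integral_mono[OF int' int le] by simp
qed

lemma L2_functions_mult:
  assumes "multiplier G m" "f \<in> L2_functions G"
  shows "(\<lambda>y. m y * f y) \<in> L2_functions G"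
  using assms L2_functions_bounded_mult[of m G _ f] unfolding multiplier_def bounded_iff by blast

lemma vnorm_L2_class:
  assumes "f \<in> L2_functions G"
  shows "vnorm (L2 G) (L2_class G f) = sqrt (LINT y|lebesgue_on G. (cmod (f y))\<^sup>2)"
proof -
  note [measurable] = L2_functionsD(1)[OF assms] L2_functionsD(1)[OF L2_rep_class(1)[OF assms]]
  have "(LINT y|lebesgue_on G. (cmod (L2_rep (L2_class G f) y))\<^sup>2) = (LINT y|lebesgue_on G. (cmod (f y))\<^sup>2)"
    by (rule integral_cong_AE) (use L2_rep_class(2)[OF assms] in auto)
  then show ?thesis by simp
qed

lemma vinner_L2_class:
  assumes "f \<in> L2_functions G" "g \<in> L2_functions G"
  shows "vinner (L2 G) (L2_class G f) (L2_class G g) = (LINT y|lebesgue_on G. f y * cnj (g y))"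
proof -
  have [measurable]: "cnj \<in> borel_measurable borel"
    by (intro borel_measurable_continuous_onI continuous_intros)
  note [measurable] = L2_functionsD(1)[OF assms(1)] L2_functionsD(1)[OF assms(2)]
    L2_functionsD(1)[OF L2_rep_class(1)[OF assms(1)]] L2_functionsD(1)[OF L2_rep_class(1)[OF assms(2)]]
  have "(LINT y|lebesgue_on G. L2_rep (L2_class G f) y * cnj (L2_rep (L2_class G g) y)) =
      (LINT y|lebesgue_on G. f y * cnj (g y))"
    by (rule integral_cong_AE)
       (use L2_rep_class(2)[OF assms(1)] L2_rep_class(2)[OF assms(2)] in \<open>auto elim: AE_mp\<close>)
  then show ?thesis by simp
qed

lemma vadd_L2_class:
  assumes "f \<in> L2_functions G" "g \<in> L2_functions G"
  shows "vadd (L2 G) (L2_class G f) (L2_class G g) = L2_class G (\<lambda>y. f y + g y)"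
  unfolding L2_simps
  by (rule L2_class_eqI)
     (use assms L2_rep_class(2)[OF assms(1)] L2_rep_class(2)[OF assms(2)] in
       \<open>auto intro!: L2_functions_add L2_rep_class elim: AE_mp\<close>)

lemma L2_mult_class:
  assumes "multiplier G m" "f \<in> L2_functions G"
  shows "L2_mult G m (L2_class G f) = L2_class G (\<lambda>y. m y * f y)"
proof -
  have "L2_mult G m (L2_class G f) = L2_class G (\<lambda>y. m y * L2_rep (L2_class G f) y)"
    using assms(2) by (simp add: L2_mult_def)
  also have "\<dots> = L2_class G (\<lambda>y. m y * f y)"
    by (rule L2_class_eqI) (use assms L2_rep_class[OF assms(2)] in \<open>auto intro!: L2_functions_mult elim: AE_mp\<close>)
  finally show ?thesis .
qed

lemma vscale_L2_class:
  assumes "f \<in> L2_functions G"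
  shows "vscale (L2 G) c (L2_class G f) = L2_class G (\<lambda>y. c * f y)"
  using L2_mult_class[OF multiplier_const assms] assms by (simp add: L2_mult_def)

text \<open>Reduces an identity of operators to classes of concrete functions; off the carrier,
  extensionality fixes the values.\<close>

lemma L2_op_eqI:
  assumes "S \<in> extensional (vcarrier (L2 G))" "T \<in> extensional (vcarrier (L2 G))"
    and "\<And>f. f \<in> L2_functions G \<Longrightarrow> S (L2_class G f) = T (L2_class G f)"
  shows "S = T"
  by (rule extensionalityI[OF assms(1,2)]) (metis L2_carrierE L2_simps(1) assms(3))

lemma L2_mult_extensional: "L2_mult G m \<in> extensional (vcarrier (L2 G))"
  by (simp add: L2_mult_def del: L2_simps)

lemma L2_mult_cong:
  assumes "\<And>y. y \<in> G \<Longrightarrow> m y = n y" "multiplier G m" "multiplier G n"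
  shows "L2_mult G m = L2_mult G n"
proof (rule L2_op_eqI[OF L2_mult_extensional L2_mult_extensional])
  fix f assume f: "f \<in> L2_functions G"
  have "L2_class G (\<lambda>y. m y * f y) = L2_class G (\<lambda>y. n y * f y)"
    by (rule L2_class_eqI) (use assms f in \<open>auto intro!: L2_functions_mult AE_I2 simp: space_restrict_space\<close>)
  then show "L2_mult G m (L2_class G f) = L2_mult G n (L2_class G f)"
    using assms f by (simp only: L2_mult_class)
qed

lemma vnorm_L2_mult_le:
  assumes "multiplier G m" "\<And>y. y \<in> G \<Longrightarrow> cmod (m y) \<le> B" "0 \<le> B" "u \<in> vcarrier (L2 G)"
  shows "vnorm (L2 G) (L2_mult G m u) \<le> B * vnorm (L2 G) u"
proof -
  obtain f where f: "f \<in> L2_functions G" and u: "u = L2_class G f"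
    using assms(4) by (auto elim: L2_carrierE)
  have "sqrt (LINT y|lebesgue_on G. (cmod (m y * f y))\<^sup>2) \<le> sqrt (B\<^sup>2 * (LINT y|lebesgue_on G. (cmod (f y))\<^sup>2))"
    using assms(1,2) f by (intro real_sqrt_le_mono integral_bounded_mult_le) (auto simp: multiplier_def)
  then show ?thesis
    unfolding u L2_mult_class[OF assms(1) f] vnorm_L2_class[OF f]
      vnorm_L2_class[OF L2_functions_mult[OF assms(1) f]]
    using assms(3) by (simp add: real_sqrt_mult)
qed

lemma L2_mult_bounded_ops:
  assumes m: "multiplier G m" shows "L2_mult G m \<in> bounded_ops (L2 G)"
proof -
  obtain B where B: "\<And>y. y \<in> G \<Longrightarrow> cmod (m y) \<le> B" and B0: "0 < B"
    using m by (auto simp: multiplier_def bounded_pos)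
  have "L2_mult G m u \<in> vcarrier (L2 G)" if "u \<in> vcarrier (L2 G)" for u
    using that m by (auto elim!: L2_carrierE simp: L2_mult_class L2_functions_mult)
  then have "L2_mult G m \<in> vcarrier (L2 G) \<rightarrow>\<^sub>E vcarrier (L2 G)"
    using L2_mult_extensional[of G m] by (auto simp: PiE_def simp del: L2_simps)
  moreover have "L2_mult G m (vadd (L2 G) u v) = vadd (L2 G) (L2_mult G m u) (L2_mult G m v)"
    if uv: "u \<in> vcarrier (L2 G)" "v \<in> vcarrier (L2 G)" for u v
  proof -
    obtain f g where "f \<in> L2_functions G" "g \<in> L2_functions G" "u = L2_class G f" "v = L2_class G g"
      using uv by (auto elim!: L2_carrierE)
    then show ?thesis
      using m by (simp add: vadd_L2_class L2_mult_class L2_functions_add L2_functions_mult distrib_left del: L2_simps)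
  qed
  moreover have "L2_mult G m (vscale (L2 G) c u) = vscale (L2 G) c (L2_mult G m u)"
    if u: "u \<in> vcarrier (L2 G)" for u c
  proof -
    obtain f where "f \<in> L2_functions G" "u = L2_class G f"
      using u by (auto elim!: L2_carrierE)
    then show ?thesis
      using m L2_functions_mult[OF multiplier_const, of f G c]
      by (simp add: vscale_L2_class L2_mult_class L2_functions_mult mult.left_commute del: L2_simps)
  qed
  moreover have "\<exists>C. \<forall>u \<in> vcarrier (L2 G). vnorm (L2 G) (L2_mult G m u) \<le> C * vnorm (L2 G) u"
    using vnorm_L2_mult_le[OF m B] B0 by (intro exI[of _ B]) (auto simp del: L2_simps)
  ultimately show ?thesis unfolding bounded_ops_def by blast
qed

lemma op_norm_L2_mult_le:
  assumes "multiplier G m" "\<And>y. y \<in> G \<Longrightarrow> cmod (m y) \<le> B" "0 \<le> B"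
  shows "op_norm (L2 G) (L2_mult G m) \<le> B"
  unfolding op_norm_def
  by (rule cInf_lower) (use vnorm_L2_mult_le[OF assms] assms(3) in \<open>auto intro: bdd_belowI[of _ 0] simp del: L2_simps\<close>)

text \<open>With the lemmas on scaling, sums, differences and composition below,
  \<open>L2_mult G\<close> is a unital algebra homomorphism on multipliers, so operator identities
  follow from pointwise ones.\<close>

lemma op_id_L2: "op_id (L2 G) = L2_mult G (\<lambda>_. 1)"
  by (rule L2_op_eqI[OF _ L2_mult_extensional])
     (simp_all add: op_id_def L2_mult_class multiplier_const)

lemma op_scale_L2_mult:
  assumes "multiplier G m"
  shows "op_scale (L2 G) c (L2_mult G m) = L2_mult G (\<lambda>y. c * m y)"
proof (rule L2_op_eqI[OF _ L2_mult_extensional])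
  show "op_scale (L2 G) c (L2_mult G m) \<in> extensional (vcarrier (L2 G))" by (simp add: op_scale_def del: L2_simps)
  fix f assume f: "f \<in> L2_functions G"
  then have "op_scale (L2 G) c (L2_mult G m) (L2_class G f) = vscale (L2 G) c (L2_class G (\<lambda>y. m y * f y))"
    by (simp add: op_scale_def L2_mult_class[OF assms] del: L2_simps(2-))
  also have "\<dots> = L2_class G (\<lambda>y. c * m y * f y)"
    by (simp only: vscale_L2_class[OF L2_functions_mult[OF assms f]] mult.assoc)
  finally show "op_scale (L2 G) c (L2_mult G m) (L2_class G f) = L2_mult G (\<lambda>y. c * m y) (L2_class G f)"
    by (simp only: L2_mult_class[OF multiplier_mult[OF multiplier_const assms] f])
qed

lemma op_add_L2_mult:
  assumes "multiplier G m" "multiplier G n"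
  shows "op_add (L2 G) (L2_mult G m) (L2_mult G n) = L2_mult G (\<lambda>y. m y + n y)"
proof (rule L2_op_eqI[OF _ L2_mult_extensional])
  show "op_add (L2 G) (L2_mult G m) (L2_mult G n) \<in> extensional (vcarrier (L2 G))"
    by (simp add: op_add_def del: L2_simps)
  fix f assume f: "f \<in> L2_functions G"
  then have "op_add (L2 G) (L2_mult G m) (L2_mult G n) (L2_class G f) =
      vadd (L2 G) (L2_class G (\<lambda>y. m y * f y)) (L2_class G (\<lambda>y. n y * f y))"
    by (simp add: op_add_def L2_mult_class assms del: L2_simps(2-))
  also have "\<dots> = L2_class G (\<lambda>y. (m y + n y) * f y)"
    using assms f by (simp only: vadd_L2_class L2_functions_mult distrib_right)
  finally show "op_add (L2 G) (L2_mult G m) (L2_mult G n) (L2_class G f) = L2_mult G (\<lambda>y. m y + n y) (L2_class G f)"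
    by (simp only: L2_mult_class[OF multiplier_add[OF assms] f])
qed

lemma op_diff_L2_mult:
  assumes "multiplier G m" "multiplier G n"
  shows "op_diff (L2 G) (L2_mult G m) (L2_mult G n) = L2_mult G (\<lambda>y. m y - n y)"
  using op_add_L2_mult[OF assms(1) multiplier_mult[OF multiplier_const[of G "-1"] assms(2)]]
  by (simp add: op_diff_def op_scale_L2_mult[OF assms(2)])

lemma op_comp_L2_mult:
  assumes "multiplier G m" "multiplier G n"
  shows "op_comp (L2 G) (L2_mult G m) (L2_mult G n) = L2_mult G (\<lambda>y. m y * n y)"
proof (rule L2_op_eqI[OF _ L2_mult_extensional])
  show "op_comp (L2 G) (L2_mult G m) (L2_mult G n) \<in> extensional (vcarrier (L2 G))"
    by (simp add: op_comp_def compose_def del: L2_simps)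
  fix f assume f: "f \<in> L2_functions G"
  then have "op_comp (L2 G) (L2_mult G m) (L2_mult G n) (L2_class G f) = L2_class G (\<lambda>y. m y * n y * f y)"
    by (simp add: op_comp_def compose_def L2_mult_class assms L2_functions_mult mult.assoc)
  then show "op_comp (L2 G) (L2_mult G m) (L2_mult G n) (L2_class G f) = L2_mult G (\<lambda>y. m y * n y) (L2_class G f)"
    by (simp only: L2_mult_class[OF multiplier_mult[OF assms] f])
qed

section \<open>Uniqueness of inverses and of weak operator integrals\<close>

lemma is_inverse_op_unique:
  assumes A: "A \<in> vcarrier V \<rightarrow> vcarrier V" and S: "is_inverse_op V A S" and T: "is_inverse_op V A T"
  shows "S = T"
proof (rule extensionalityI)
  show "S \<in> extensional (vcarrier V)" "T \<in> extensional (vcarrier V)"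
    using S T by (auto simp: is_inverse_op_def bounded_ops_def PiE_iff)
  fix u assume u: "u \<in> vcarrier V"
  have Tu: "T u \<in> vcarrier V" using T u by (auto simp: is_inverse_op_def bounded_ops_def)
  \<comment> \<open>A left inverse equals a right inverse:
    \<open>S u = S (A (T u)) = T u\<close>.\<close>
  have "A (T u) = u"
    using T u by (auto simp: is_inverse_op_def op_comp_def op_id_def compose_def dest: fun_cong[of _ _ u])
  moreover have "S (A (T u)) = T u"
    using S Tu by (auto simp: is_inverse_op_def op_comp_def op_id_def compose_def dest: fun_cong[of _ _ "T u"])
  ultimately show "S u = T u" by simp
qed

lemma resolvent_eqI:
  assumes "op_diff V (op_scale V z (op_id V)) A \<in> vcarrier V \<rightarrow> vcarrier V"
    and "is_inverse_op V (op_diff V (op_scale V z (op_id V)) A) T"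
  shows "resolvent V A z = T"
  unfolding resolvent_def using assms is_inverse_op_unique by (intro the_equality) blast+

lemma integrable_L2_mult_cnj:
  assumes "f \<in> L2_functions G" "g \<in> L2_functions G"
  shows "integrable (lebesgue_on G) (\<lambda>y. f y * cnj (g y))"
proof (rule Bochner_Integration.integrable_bound)
  have [measurable]: "cnj \<in> borel_measurable borel"
    by (intro borel_measurable_continuous_onI continuous_intros)
  note [measurable] = L2_functionsD(1)[OF assms(1)] L2_functionsD(1)[OF assms(2)]
  show "integrable (lebesgue_on G) (\<lambda>y. (cmod (f y))\<^sup>2 + (cmod (g y))\<^sup>2)"
    using assms by (simp add: L2_functions_def)
  have "a * b \<le> a\<^sup>2 + b\<^sup>2" if "0 \<le> a" "0 \<le> b" for a b :: real
  proof -
    have "0 \<le> a * b" using that by simp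
    with zero_le_power2[of "a - b"] show ?thesis by (simp add: power2_diff)
  qed
  then show "AE y in lebesgue_on G. norm (f y * cnj (g y)) \<le> norm ((cmod (f y))\<^sup>2 + (cmod (g y))\<^sup>2)"
    by (simp add: norm_mult)
  show "(\<lambda>y. f y * cnj (g y)) \<in> borel_measurable (lebesgue_on G)" by measurable
qed

text \<open>Test with h = f - g: the difference of the two inner products is then the squared norm
  of f - g.\<close>

lemma L2_inner_separates:
  assumes f: "f \<in> L2_functions G" and g: "g \<in> L2_functions G"
    and eq: "\<And>h. h \<in> L2_functions G \<Longrightarrow>
      vinner (L2 G) (L2_class G f) (L2_class G h) = vinner (L2 G) (L2_class G g) (L2_class G h)"
  shows "L2_class G f = L2_class G g"
proof -
  define h where "h y = f y - g y" for y
  have h: "h \<in> L2_functions G"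
    using L2_functions_add[OF f L2_functions_mult[OF multiplier_const[of G "-1"] g]] by (simp add: h_def[abs_def])
  have "(LINT y|lebesgue_on G. f y * cnj (h y)) = (LINT y|lebesgue_on G. g y * cnj (h y))"
    using eq[OF h] f g h by (simp only: vinner_L2_class)
  then have "(LINT y|lebesgue_on G. f y * cnj (h y) - g y * cnj (h y)) = 0"
    using integrable_L2_mult_cnj[OF f h] integrable_L2_mult_cnj[OF g h] by simp
  also have "(\<lambda>y. f y * cnj (h y) - g y * cnj (h y)) = (\<lambda>y. of_real ((cmod (h y))\<^sup>2))"
    unfolding complex_norm_square by (simp add: h_def algebra_simps)
  finally have "(LINT y|lebesgue_on G. (cmod (h y))\<^sup>2) = 0" by (simp only: integral_complex_of_real of_real_eq_0_iff)
  then have "AE y in lebesgue_on G. (cmod (h y))\<^sup>2 = 0"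
    using integral_nonneg_eq_0_iff_AE[OF L2_functionsD(2)[OF h]] by simp
  then show ?thesis
    by (intro L2_class_eqI f g) (simp add: h_def)
qed

text \<open>Two weak integrals have the same matrix elements, and these determine an operator; so
  the definite description in \<open>op_integral\<close> is well defined.\<close>

lemma op_integral_L2_eqI:
  assumes T: "has_op_integral (L2 G) A F T"
  shows "op_integral (L2 G) A F = T"
  unfolding op_integral_def
proof (rule the_equality)
  show "has_op_integral (L2 G) A F T" by (rule T)
  fix S assume S: "has_op_integral (L2 G) A F S"
  note bd = S[unfolded has_op_integral_def, THEN conjunct1] T[unfolded has_op_integral_def, THEN conjunct1]
  show "S = T"
  proof (rule L2_op_eqI)
    show "S \<in> extensional (vcarrier (L2 G))" "T \<in> extensional (vcarrier (L2 G))"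
      using bd by (auto simp: bounded_ops_def PiE_iff simp del: L2_simps)
    fix f assume f: "f \<in> L2_functions G"
    let ?u = "L2_class G f"
    have u: "?u \<in> vcarrier (L2 G)" using f by simp
    then have "S ?u \<in> vcarrier (L2 G)" "T ?u \<in> vcarrier (L2 G)"
      using bd by (auto simp: bounded_ops_def simp del: L2_simps)
    then obtain s t where st: "s \<in> L2_functions G" "t \<in> L2_functions G" "S ?u = L2_class G s" "T ?u = L2_class G t"
      by (auto elim!: L2_carrierE)
    show "S ?u = T ?u" unfolding st(3,4)
    proof (rule L2_inner_separates[OF st(1,2)])
      fix h assume "h \<in> L2_functions G"
      then have "L2_class G h \<in> vcarrier (L2 G)" by simp
      then have "vinner (L2 G) (S ?u) (L2_class G h) = vinner (L2 G) (T ?u) (L2_class G h)"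
        using S T u unfolding has_op_integral_def by metis
      then show "vinner (L2 G) (L2_class G s) (L2_class G h) = vinner (L2 G) (L2_class G t) (L2_class G h)"
        by (simp only: st)
    qed
  qed
qed

section \<open>The resolvent distribution of a multiplication operator\<close>

text \<open>The operator integral leaves out the real axis, where the resolvent need not exist; the
  scalar integrals of the Cauchy transform run over the whole plane. This reconciles the
  two.\<close>

lemma AE_lborel_Im_nonzero: "AE z in lborel. Im z \<noteq> 0"
proof -
  have "negligible {z::complex. \<i> \<bullet> z = 0}" by (rule negligible_hyperplane) simp
  then have "{z::complex. Im z = 0} \<in> null_sets lebesgue"
    by (simp add: negligible_iff_null_sets inner_complex_def)
  then have "AE z in lebesgue. Im z \<noteq> 0" using AE_not_in by fastforce
  then show ?thesis by (simp add: AE_completion_iff)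
qed

context
  fixes G :: "'a::euclidean_space set" and P :: "'a \<Rightarrow> real"
  assumes G: "G \<in> lmeasurable" and P_measurable: "P \<in> borel_measurable (lebesgue_on G)"
    and P_bounded: "bounded (P ` G)"
begin

lemma multiplier_symbol: "multiplier G (\<lambda>y. complex_of_real (P y))"
  using P_measurable P_bounded by (auto simp: multiplier_def bounded_iff)

lemma multiplier_cauchy_transform:
  assumes "cs_bounded \<phi>"
  shows "multiplier G (\<lambda>y. cauchy_transform \<phi> (of_real (P y)))"
  using measurable_compose[OF multiplier_symbol[unfolded multiplier_def, THEN conjunct1] measurable_cauchy_transform[OF assms]]
    bounded_cauchy_transform[OF assms]
  by (auto simp: multiplier_def intro: bounded_subset)

text \<open>\<open>P\<close> is real, so |Im z| bounds the denominator from below.\<close>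

lemma multiplier_resolvent:
  assumes "Im z \<noteq> 0"
  shows "multiplier G (\<lambda>y. 1 / (z - of_real (P y)))"
proof -
  have "cmod (1 / (z - of_real (P y))) \<le> 1 / \<bar>Im z\<bar>" for y
  proof -
    have le: "\<bar>Im z\<bar> \<le> cmod (z - of_real (P y))"
      using abs_Im_le_cmod[of "z - of_real (P y)"] by simp
    show ?thesis
      unfolding norm_divide norm_one by (rule frac_le) (use le assms in auto)
  qed
  moreover have "(\<lambda>y. 1 / (z - of_real (P y))) \<in> borel_measurable (lebesgue_on G)"
    using P_measurable by measurable
  ultimately show ?thesis by (auto simp: multiplier_def intro!: boundedI)
qed

lemma op_diff_symbol:
  "op_diff (L2 G) (op_scale (L2 G) z (op_id (L2 G))) (L2_mult G (\<lambda>y. complex_of_real (P y))) =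
    L2_mult G (\<lambda>y. z - of_real (P y))"
  by (simp add: op_id_L2 op_scale_L2_mult op_diff_L2_mult multiplier_const multiplier_symbol)

lemma is_inverse_op_resolvent:
  assumes "Im z \<noteq> 0"
  shows "is_inverse_op (L2 G)
    (op_diff (L2 G) (op_scale (L2 G) z (op_id (L2 G))) (L2_mult G (\<lambda>y. complex_of_real (P y))))
    (L2_mult G (\<lambda>y. 1 / (z - of_real (P y))))"
proof -
  have m: "multiplier G (\<lambda>y. z - of_real (P y))"
    by (intro multiplier_diff multiplier_const multiplier_symbol)
  note r = multiplier_resolvent[OF assms]
  have nz: "z - of_real (P y) \<noteq> 0" for y using assms by (auto simp: complex_eq_iff)
  show ?thesis
    unfolding is_inverse_op_def op_diff_symbol
    unfolding op_comp_L2_mult[OF m r] op_comp_L2_mult[OF r m] op_id_L2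
    using nz by (auto intro!: L2_mult_bounded_ops r L2_mult_cong multiplier_mult[OF m r, simplified]
        multiplier_mult[OF r m, simplified] simp: multiplier_const simp del: L2_simps)
qed

lemma resolvent_symbol:
  assumes "Im z \<noteq> 0"
  shows "resolvent (L2 G) (L2_mult G (\<lambda>y. complex_of_real (P y))) z = L2_mult G (\<lambda>y. 1 / (z - of_real (P y)))"
proof (rule resolvent_eqI[OF _ is_inverse_op_resolvent[OF assms]])
  have "L2_mult G (\<lambda>y. z - of_real (P y)) \<in> bounded_ops (L2 G)"
    by (intro L2_mult_bounded_ops multiplier_diff multiplier_const multiplier_symbol)
  then show "op_diff (L2 G) (op_scale (L2 G) z (op_id (L2 G))) (L2_mult G (\<lambda>y. complex_of_real (P y)))
      \<in> vcarrier (L2 G) \<rightarrow> vcarrier (L2 G)"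
    unfolding op_diff_symbol by (auto simp: bounded_ops_def simp del: L2_simps)
qed

text \<open>Tonelli with \<open>z\<close> innermost: the uniform Cauchy bound \<open>C\<close> holds
  for every value P(y) and leaves only the integral of |h|. Bounding the kernel uniformly in y for
  fixed z would give the non-integrable 1/|Im z| instead.\<close>

lemma integrable_cauchy_kernel_symbol:
  assumes \<phi>: "cs_bounded \<phi>" and h: "integrable (lebesgue_on G) h"
  shows "integrable (lborel \<Otimes>\<^sub>M lebesgue_on G) (\<lambda>(z, y). \<phi> z / (z - of_real (P y)) * h y)"
proof -
  interpret finite_measure "lebesgue_on G"
    using G by (intro finite_measureI) (auto simp: emeasure_restrict_space fmeasurable_def space_restrict_space)
  interpret pair_sigma_finite lborel "lebesgue_on G" ..
  have [measurable]: "\<phi> \<in> borel_measurable borel" using \<phi> by (simp add: cs_bounded_def)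
  note [measurable] = P_measurable borel_measurable_integrable[OF h]
  obtain C where C: "0 \<le> C"
    "\<And>p. (\<integral>\<^sup>+z. ennreal (cmod (\<phi> z / (z - p))) \<partial>lborel) \<le> ennreal C"
    using cs_bounded_cauchy_bound[OF \<phi>] by blast
  let ?f = "\<lambda>(z, y). \<phi> z / (z - of_real (P y)) * h y"
  have meas: "?f \<in> borel_measurable (lborel \<Otimes>\<^sub>M lebesgue_on G)"
    by measurable
  have "(\<integral>\<^sup>+x. ennreal (norm (?f x)) \<partial>(lborel \<Otimes>\<^sub>M lebesgue_on G)) =
      (\<integral>\<^sup>+y. \<integral>\<^sup>+z. ennreal (norm (?f (z, y))) \<partial>lborel \<partial>lebesgue_on G)"
    using meas by (subst nn_integral_snd[symmetric]) auto
  also have "\<dots> = (\<integral>\<^sup>+y. \<integral>\<^sup>+z. ennreal (cmod (\<phi> z / (z - of_real (P y)))) * ennreal (cmod (h y)) \<partial>lborel \<partial>lebesgue_on G)"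
    by (simp only: prod.case norm_mult ennreal_mult norm_ge_zero)
  also have "\<dots> = (\<integral>\<^sup>+y. (\<integral>\<^sup>+z. ennreal (cmod (\<phi> z / (z - of_real (P y)))) \<partial>lborel) * ennreal (cmod (h y)) \<partial>lebesgue_on G)"
    by (intro nn_integral_cong nn_integral_multc) simp
  also have "\<dots> \<le> (\<integral>\<^sup>+y. ennreal C * ennreal (cmod (h y)) \<partial>lebesgue_on G)"
    by (intro nn_integral_mono mult_right_mono C) auto
  also have "\<dots> = ennreal C * (\<integral>\<^sup>+y. ennreal (cmod (h y)) \<partial>lebesgue_on G)"
    by (intro nn_integral_cmult) simp
  also have "\<dots> < \<infinity>"
    using h by (simp add: integrable_iff_bounded ennreal_mult_less_top)
  finally show ?thesis using meas by (intro integrableI_bounded)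
qed

text \<open>Fubini moves the \<open>z\<close>-integral inside the inner product of \<open>L\<^sup>2(G)\<close>; the real axis is a null set.\<close>

lemma has_op_integral_resolvent:
  assumes \<phi>: "cs_bounded \<phi>"
  shows "has_op_integral (L2 G) {z. Im z \<noteq> 0}
    (\<lambda>z. op_scale (L2 G) (\<phi> z) (resolvent (L2 G) (L2_mult G (\<lambda>y. complex_of_real (P y))) z))
    (L2_mult G (\<lambda>y. cauchy_transform \<phi> (of_real (P y))))"
  unfolding has_op_integral_def
proof (intro conjI ballI)
  note ct = multiplier_cauchy_transform[OF \<phi>]
  show "L2_mult G (\<lambda>y. cauchy_transform \<phi> (of_real (P y))) \<in> bounded_ops (L2 G)"
    by (intro L2_mult_bounded_ops ct)
  fix u v assume "u \<in> vcarrier (L2 G)" "v \<in> vcarrier (L2 G)"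
  then obtain f g where f: "f \<in> L2_functions G" and g: "g \<in> L2_functions G"
    and u: "u = L2_class G f" and v: "v = L2_class G g"
    by (auto elim!: L2_carrierE)
  interpret finite_measure "lebesgue_on G"
    using G by (intro finite_measureI) (auto simp: emeasure_restrict_space fmeasurable_def space_restrict_space)
  interpret pair_sigma_finite lborel "lebesgue_on G" ..
  let ?F = "\<lambda>z. vinner (L2 G)
    (op_scale (L2 G) (\<phi> z) (resolvent (L2 G) (L2_mult G (\<lambda>y. complex_of_real (P y))) z) u) v"
  let ?K = "\<lambda>z y. \<phi> z / (z - of_real (P y)) * (f y * cnj (g y))"
  have K: "integrable (lborel \<Otimes>\<^sub>M lebesgue_on G) (\<lambda>(z, y). ?K z y)"
    using integrable_cauchy_kernel_symbol[OF \<phi> integrable_L2_mult_cnj[OF f g]] .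
  have F: "?F z = (LINT y|lebesgue_on G. ?K z y)" if z: "Im z \<noteq> 0" for z
  proof -
    note r = multiplier_resolvent[OF z]
    note s = multiplier_mult[OF multiplier_const[of G "\<phi> z"] r]
    have "?F z = (LINT y|lebesgue_on G. \<phi> z * (1 / (z - of_real (P y))) * f y * cnj (g y))"
      unfolding u v resolvent_symbol[OF z] op_scale_L2_mult[OF r] L2_mult_class[OF s f]
      by (rule vinner_L2_class[OF L2_functions_mult[OF s f] g])
    then show ?thesis by (simp add: mult.assoc)
  qed
  have int: "integrable lborel (\<lambda>z. LINT y|lebesgue_on G. ?K z y)"
    using integrable_fst[OF K] .
  have AE_eq: "AE z in lborel. (LINT y|lebesgue_on G. ?K z y) = indicator {z. Im z \<noteq> 0} z *\<^sub>R ?F z"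
    using AE_lborel_Im_nonzero
  proof eventually_elim
    case (elim z)
    show ?case unfolding F[OF elim] using elim by simp
  qed
  \<comment> \<open>\<open>resolvent\<close> is a definite description, so the measurability of
    \<open>?F\<close> in \<open>z\<close> is read off from the parameter integral with which it
    agrees off the real axis.\<close>
  have meas: "(\<lambda>z. indicator {z. Im z \<noteq> 0} z *\<^sub>R ?F z) \<in> borel_measurable lborel"
  proof -
    have "(\<lambda>z. indicator {z. Im z \<noteq> 0} z *\<^sub>R ?F z) =
        (\<lambda>z. indicator {z. Im z \<noteq> 0} z *\<^sub>R (LINT y|lebesgue_on G. ?K z y))"
    proof
      fix z
      show "indicator {z. Im z \<noteq> 0} z *\<^sub>R ?F z =
          indicator {z. Im z \<noteq> 0} z *\<^sub>R (LINT y|lebesgue_on G. ?K z y)"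
      proof (cases "Im z = 0")
        case False
        show ?thesis unfolding F[OF False] ..
      qed simp
    qed
    moreover have "{z. Im z \<noteq> 0} \<in> sets lborel" by measurable
    ultimately show ?thesis
      using borel_measurable_integrable[OF int] by (simp only: borel_measurable_scaleR borel_measurable_indicator)
  qed
  show "set_integrable lborel {z. Im z \<noteq> 0} ?F"
    unfolding set_integrable_def by (rule integrable_cong_AE_imp[OF int meas AE_eq])
  have "set_lebesgue_integral lborel {z. Im z \<noteq> 0} ?F = (LINT z|lborel. LINT y|lebesgue_on G. ?K z y)"
    unfolding set_lebesgue_integral_def
    by (rule integral_cong_AE[OF meas borel_measurable_integrable[OF int] AE_symmetric[OF AE_eq]])
  also have "\<dots> = (LINT y|lebesgue_on G. LINT z|lborel. ?K z y)"
    by (rule Fubini_integral[OF K, symmetric])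
  also have "\<dots> = (LINT y|lebesgue_on G. cauchy_transform \<phi> (of_real (P y)) * f y * cnj (g y))"
    by (simp only: integral_mult_left_zero cauchy_transform_def mult.assoc)
  also have "\<dots> = vinner (L2 G) (L2_mult G (\<lambda>y. cauchy_transform \<phi> (of_real (P y))) u) v"
    unfolding u v L2_mult_class[OF ct f]
    by (rule vinner_L2_class[OF L2_functions_mult[OF ct f] g, symmetric])
  finally show "set_lebesgue_integral lborel {z. Im z \<noteq> 0} ?F =
    vinner (L2 G) (L2_mult G (\<lambda>y. cauchy_transform \<phi> (of_real (P y))) u) v" .
qed

text \<open>Stated for \<open>cs_bounded\<close> functions, so that it covers the products
  \<open>\<phi> C\<psi>\<close> of the resolvent equation and \<open>dbar \<phi>\<close> as well as
  test functions.\<close>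

lemma resolvent_distribution_eq:
  assumes "cs_bounded \<phi>"
  shows "resolvent_distribution G (L2_mult G (\<lambda>y. complex_of_real (P y))) \<phi> =
    L2_mult G (\<lambda>y. cauchy_transform \<phi> (of_real (P y)))"
  unfolding resolvent_distribution_def
  by (rule op_integral_L2_eqI[OF has_op_integral_resolvent[OF assms]])

lemma op_distribution_resolvent:
  "op_distribution (L2 G) (resolvent_distribution G (L2_mult G (\<lambda>y. complex_of_real (P y))))"
  unfolding op_distribution_def
proof (intro conjI ballI allI impI)
  let ?R = "resolvent_distribution G (L2_mult G (\<lambda>y. complex_of_real (P y)))"
  fix \<phi> \<psi> assume \<phi>: "\<phi> \<in> test_functions" and \<psi>: "\<psi> \<in> test_functions"
  note cs = cs_bounded_test_function[OF \<phi>] cs_bounded_test_function[OF \<psi>]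
  show "?R (\<lambda>z. \<phi> z + \<psi> z) = op_add (L2 G) (?R \<phi>) (?R \<psi>)"
    using cs by (simp add: resolvent_distribution_eq cs_bounded_add cauchy_transform_add
        op_add_L2_mult multiplier_cauchy_transform del: L2_simps)
next
  let ?R = "resolvent_distribution G (L2_mult G (\<lambda>y. complex_of_real (P y)))"
  fix \<phi> c assume \<phi>: "\<phi> \<in> test_functions"
  note cs = cs_bounded_test_function[OF \<phi>]
  show "?R \<phi> \<in> bounded_ops (L2 G)"
    using cs by (simp add: resolvent_distribution_eq L2_mult_bounded_ops multiplier_cauchy_transform)
  show "?R (\<lambda>z. c * \<phi> z) = op_scale (L2 G) c (?R \<phi>)"
    using cs by (simp add: resolvent_distribution_eq cs_bounded_cmult cauchy_transform_cmult
        op_scale_L2_mult multiplier_cauchy_transform del: L2_simps)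
next
  let ?R = "resolvent_distribution G (L2_mult G (\<lambda>y. complex_of_real (P y)))"
  fix K :: "complex set" assume K: "compact K"
  obtain A where A: "0 \<le> A"
    "\<And>\<phi> S B p. \<phi> \<in> borel_measurable borel \<Longrightarrow> S \<in> sets borel \<Longrightarrow> emeasure lborel S < \<infinity> \<Longrightarrow>
       (\<And>z. cmod (\<phi> z) \<le> B) \<Longrightarrow> {z. \<phi> z \<noteq> 0} \<subseteq> S \<Longrightarrow>
       (\<integral>\<^sup>+z. ennreal (cmod (\<phi> z / (z - p))) \<partial>lborel) \<le> ennreal (B * (A + measure lborel S))"
    using cauchy_integrand_bound by blast
  \<comment> \<open>The distribution has order zero: the supremum of \<open>\<phi>\<close> times a
    constant of \<open>K\<close> bounds the symbol, so \<open>N = 0\<close> works for every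
    \<open>K\<close>.\<close>
  have "op_norm (L2 G) (?R \<phi>) \<le> (A + measure lborel K) * test_seminorm 0 \<phi>"
    if \<phi>: "\<phi> \<in> test_functions" and supp: "fsupport \<phi> \<subseteq> K" for \<phi>
  proof -
    note cs = cs_bounded_test_function[OF \<phi>]
    have "{vs \<in> lists (Basis :: complex set). length vs \<le> 0} = {[]}" by auto
    then have semi: "test_seminorm 0 \<phi> = (SUP z. cmod (\<phi> z))" by (simp add: test_seminorm_def)
    have "bdd_above (range (\<lambda>z. cmod (\<phi> z)))"
      using cs bdd_above_norm[of "range \<phi>"] by (simp add: cs_bounded_def image_image)
    then have B: "cmod (\<phi> z) \<le> test_seminorm 0 \<phi>" for z
      unfolding semi by (rule cSUP_upper[OF UNIV_I])
    then have B0: "0 \<le> test_seminorm 0 \<phi>" by (rule order_trans[OF norm_ge_zero])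
    have S: "{z. \<phi> z \<noteq> 0} \<subseteq> K" using supp closure_subset[of "{z. \<phi> z \<noteq> 0}"] by (auto simp: fsupport_def)
    have "cmod (cauchy_transform \<phi> p) \<le> test_seminorm 0 \<phi> * (A + measure lborel K)" for p
      by (rule norm_cauchy_transform_le[OF cs A(2)[OF cs_bounded_measurable[OF cs] _ _ B S]])
         (use K A(1) B0 in \<open>auto simp: borel_compact emeasure_compact_finite[unfolded infinity_ennreal_def]\<close>)
    then show ?thesis
      unfolding resolvent_distribution_eq[OF cs]
      using A(1) B0 by (intro op_norm_L2_mult_le multiplier_cauchy_transform cs) (auto simp: mult.commute)
  qed
  then show "\<exists>C N. \<forall>\<phi>\<in>test_functions. fsupport \<phi> \<subseteq> K \<longrightarrow> op_norm (L2 G) (?R \<phi>) \<le> C * test_seminorm N \<phi>"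
    by blast
qed

lemma distribution_resolvent_equation_resolvent:
  "distribution_resolvent_equation (L2 G) (resolvent_distribution G (L2_mult G (\<lambda>y. complex_of_real (P y))))"
  unfolding distribution_resolvent_equation_def
proof (intro ballI)
  let ?R = "resolvent_distribution G (L2_mult G (\<lambda>y. complex_of_real (P y)))"
  fix \<phi> \<psi> assume "\<phi> \<in> test_functions" "\<psi> \<in> test_functions"
  then have \<phi>: "cs_bounded \<phi>" and \<psi>: "cs_bounded \<psi>" by (simp_all add: cs_bounded_test_function)
  have cs: "cs_bounded (\<lambda>z. \<phi> z * cauchy_transform \<psi> z)" "cs_bounded (\<lambda>z. \<psi> z * cauchy_transform \<phi> z)"
    using \<phi> \<psi> by (auto intro!: cs_bounded_mult measurable_cauchy_transform bounded_cauchy_transform)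
  \<comment> \<open>Here the fixed point \<open>w\<close> stands first in the denominator, opposite
    to the Cauchy transform; this sign turns the difference in the resolvent equation into the sum
    of \<open>cauchy_transform_mult\<close>.\<close>
  have "(LINT z|lborel. \<phi> z / (w - z)) = - cauchy_transform \<phi> w" for w
  proof -
    have "\<phi> z / (w - z) = - (\<phi> z / (z - w))" for z
      by (metis minus_diff_eq minus_divide_right)
    then show ?thesis by (simp add: cauchy_transform_def)
  qed
  \<comment> \<open>The sign is written as the factor \<open>- 1\<close> to match the rules for
    scalar multiples.\<close>
  then have psi: "(\<lambda>w. \<psi> w * (LINT z|lborel. \<phi> z / (w - z))) = (\<lambda>w. - 1 * (\<psi> w * cauchy_transform \<phi> w))"
    by simp
  have phi: "(\<lambda>z. \<phi> z * (LINT w|lborel. \<psi> w / (w - z))) = (\<lambda>z. \<phi> z * cauchy_transform \<psi> z)"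
    by (simp add: cauchy_transform_def)
  have comp: "op_comp (L2 G) (?R \<phi>) (?R \<psi>) =
      L2_mult G (\<lambda>y. cauchy_transform \<phi> (of_real (P y)) * cauchy_transform \<psi> (of_real (P y)))"
    using \<phi> \<psi> by (simp add: resolvent_distribution_eq op_comp_L2_mult multiplier_cauchy_transform del: L2_simps)
  have diff: "op_diff (L2 G) (?R (\<lambda>z. \<phi> z * cauchy_transform \<psi> z)) (?R (\<lambda>w. - 1 * (\<psi> w * cauchy_transform \<phi> w))) =
      L2_mult G (\<lambda>y. cauchy_transform (\<lambda>z. \<phi> z * cauchy_transform \<psi> z) (of_real (P y)) -
        cauchy_transform (\<lambda>w. - 1 * (\<psi> w * cauchy_transform \<phi> w)) (of_real (P y)))"
    unfolding resolvent_distribution_eq[OF cs(1)] resolvent_distribution_eq[OF cs_bounded_cmult[OF cs(2)]]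
    by (intro op_diff_L2_mult multiplier_cauchy_transform cs(1) cs_bounded_cmult[OF cs(2)])
  show "op_comp (L2 G) (?R \<phi>) (?R \<psi>) =
      op_diff (L2 G) (?R (\<lambda>z. \<phi> z * (LINT w|lborel. \<psi> w / (w - z))))
                     (?R (\<lambda>w. \<psi> w * (LINT z|lborel. \<phi> z / (w - z))))"
    unfolding psi phi comp diff cauchy_transform_cmult cauchy_transform_mult[OF \<phi> \<psi>] by simp
qed

text \<open>The factors 1/pi and -1 from the two definitions cancel the -pi of the Cauchy-Pompeiu
  formula.\<close>

lemma spectral_distribution_resolvent:
  assumes "\<phi> \<in> test_functions"
  shows "spectral_distribution (L2 G) (resolvent_distribution G (L2_mult G (\<lambda>y. complex_of_real (P y)))) \<phi> =
    L2_mult G (\<lambda>y. \<phi> (of_real (P y)))"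
proof -
  note ct = multiplier_cauchy_transform[OF cs_bounded_dbar[OF assms]]
  show ?thesis
    unfolding spectral_distribution_def distr_dbar_def resolvent_distribution_eq[OF cs_bounded_dbar[OF assms]]
      op_scale_L2_mult[OF ct] op_scale_L2_mult[OF multiplier_mult[OF multiplier_const ct]]
    by (simp add: cauchy_pompeiu[OF assms])
qed

lemma multiplier_test_function:
  assumes "\<phi> \<in> test_functions"
  shows "multiplier G (\<lambda>y. \<phi> (of_real (P y)))"
  using cs_bounded_test_function[OF assms]
    measurable_compose[OF multiplier_symbol[unfolded multiplier_def, THEN conjunct1] cs_bounded_measurable]
  by (auto simp: multiplier_def cs_bounded_def intro: bounded_subset)

end

theorem mainTheorem7:
  fixes G :: "(real ^ 'n) set" and P :: "real ^ 'n \<Rightarrow> real"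
  assumes "open G" and "bounded G"
    and "smooth_on G P" and "bounded_derivs_on G P"
    and "\<And>y. y \<in> G \<Longrightarrow> gradient P y \<noteq> 0"
  defines "V \<equiv> L2 G"
    and "\<Omega> \<equiv> L2_mult G (\<lambda>y. complex_of_real (P y))"
  defines "R \<equiv> resolvent_distribution G \<Omega>"
  shows "\<Omega> \<in> bounded_ops V \<and>
    (\<forall>f \<in> L2_functions G.
       \<Omega> (L2_class G f) = L2_class G (\<lambda>y. complex_of_real (P y) * f y)) \<and>
    (\<forall>z. Im z \<noteq> 0 \<longrightarrow> z \<in> resolvent_set V \<Omega>) \<and>
    (\<forall>\<phi> \<in> test_functions.
       op_integrable V {z. Im z \<noteq> 0} (\<lambda>z. op_scale V (\<phi> z) (resolvent V \<Omega> z)) \<and>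
       (\<forall>y \<in> G. integrable lborel (\<lambda>z. \<phi> z / (z - complex_of_real (P y)))) \<and>
       (\<forall>f \<in> L2_functions G.
          R \<phi> (L2_class G f) =
            L2_class G (\<lambda>y. (LINT z|lborel. \<phi> z / (z - complex_of_real (P y))) * f y))) \<and>
    op_distribution V R \<and>
    distribution_resolvent_equation V R \<and>
    (\<forall>\<phi> \<in> test_functions. \<forall>f \<in> L2_functions G.
       spectral_distribution V R \<phi> (L2_class G f) =
         L2_class G (\<lambda>y. \<phi> (complex_of_real (P y)) * f y))"
proof -
  have G: "G \<in> lmeasurable"
    using assms(1,2) by (rule lmeasurable_open[rotated])
  \<comment> \<open>The empty list of directions stands for \<open>P\<close> itself, here and in the
    proof of \<open>P_bounded\<close>.\<close>
  have "P differentiable (at y)" if "y \<in> G" for y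
    using assms(3) that by (auto simp: smooth_on_def dest: bspec[of _ _ "[]"])
  then have "continuous_on G P"
    by (intro continuous_at_imp_continuous_on) (auto intro: differentiable_imp_continuous_within)
  then have P_measurable: "P \<in> borel_measurable (lebesgue_on G)"
    using G by (intro continuous_imp_measurable_on_sets_lebesgue) (auto simp: fmeasurable_def)
  have P_bounded: "bounded (P ` G)"
    using assms(4) by (auto simp: bounded_derivs_on_def dest: bspec[of _ _ "[]"])
  note P = G P_measurable P_bounded
  show ?thesis
  proof (intro conjI ballI allI impI)
    show "\<Omega> \<in> bounded_ops V"
      unfolding \<Omega>_def V_def by (rule L2_mult_bounded_ops[OF multiplier_symbol[OF P]])
    show "\<Omega> (L2_class G f) = L2_class G (\<lambda>y. complex_of_real (P y) * f y)" if "f \<in> L2_functions G" for f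
      unfolding \<Omega>_def by (rule L2_mult_class[OF multiplier_symbol[OF P] that])
    show "z \<in> resolvent_set V \<Omega>" if "Im z \<noteq> 0" for z
      unfolding resolvent_set_def \<Omega>_def V_def using is_inverse_op_resolvent[OF P that] by blast
    show "op_distribution V R" "distribution_resolvent_equation V R"
      unfolding R_def \<Omega>_def V_def
      by (rule op_distribution_resolvent[OF P], rule distribution_resolvent_equation_resolvent[OF P])
    fix \<phi> assume \<phi>: "\<phi> \<in> test_functions"
    note cs = cs_bounded_test_function[OF \<phi>]
    show "op_integrable V {z. Im z \<noteq> 0} (\<lambda>z. op_scale V (\<phi> z) (resolvent V \<Omega> z))"
      unfolding op_integrable_def \<Omega>_def V_def using has_op_integral_resolvent[OF P cs] by blast
    show "integrable lborel (\<lambda>z. \<phi> z / (z - complex_of_real (P y)))" for y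
      by (rule cauchy_integrable[OF cs])
    fix f assume f: "f \<in> L2_functions G"
    show "R \<phi> (L2_class G f) = L2_class G (\<lambda>y. (LINT z|lborel. \<phi> z / (z - complex_of_real (P y))) * f y)"
      unfolding R_def \<Omega>_def resolvent_distribution_eq[OF P cs]
        L2_mult_class[OF multiplier_cauchy_transform[OF P cs] f]
      by (simp only: cauchy_transform_def)
    show "spectral_distribution V R \<phi> (L2_class G f) = L2_class G (\<lambda>y. \<phi> (complex_of_real (P y)) * f y)"
      unfolding R_def \<Omega>_def V_def spectral_distribution_resolvent[OF P \<phi>]
      by (rule L2_mult_class[OF multiplier_test_function[OF P \<phi>] f])
  qed
qed

end
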